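(* Let $0<a<1$, $\alpha>-1$ and $\phi(z)=az+(1-a)$. For each $n\in\mathbb{N}\cup\{0\}$, the $n$th iterated Aluthge transform of the composition operator $C_\phi$ on $\mathcal{A}_\alpha^2(\mathbb{D})$ is $$\widetilde{C_\phi}^{(n)}=T_f C_\psi,$$ where $$f(z)=\left(\frac{2^{n+1}a^n}{-(1-a)\big((1+a)^n-2^na^n\big)z+(1+a)\big((1-a)(1+a)^{n-1}+2^na^n\big)}\right)^{\alpha+2},$$ $$\psi(z)=\frac{-(1+a)\big((1-a)(1+a)^{n-1}-2^na^n\big)z+(1-a)\big((1+a)^n+2^na^n\big)}{-(1-a)\big((1+a)^n-2^na^n\big)z+(1+a)\big((1-a)(1+a)^{n-1}+2^na^n\big)}.$$
   Context: $\mathbb{D}$ is the open unit disk in $\mathbb{C}$. For $\alpha>-1$, the weighted Bergman space $\mathcal{A}_\alpha^2(\mathbb{D})$ is the Hilbert space of analytic functions $f(z)=\sum_{n\ge0}a_nz^n$ on $\mathbb{D}$ with $\sum_n \frac{n!\,\Gamma(\alpha+2)}{\Gamma(n+\alpha+2)}|a_n|^2<\infty$, with inner product $\langle \sum a_nz^n,\sum b_nz^n\rangle=\sum_{n}\frac{n!\,\Gamma(\alpha+2)}{\Gamma(n+\alpha+2)}a_n\overline{b_n}$. For a bounded analytic function $f$ on $\mathbb{D}$, the (analytic Toeplitz) operator $T_f$ is $T_fh=fh$; for an analytic self-map $\phi$ of $\mathbb{D}$, $C_\phi h=h\circ\phi$. Both are bounded on $\mathcal{A}_\alpha^2(\mathbb{D})$.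 Powers with exponent $\alpha+2$ are taken with the principal branch (the base has positive real part on $\mathbb{D}$). For a bounded operator $T$ on a Hilbert space $H$, let $|T|=(T^*T)^{1/2}$ and let $T=U|T|$ be the polar decomposition, $U$ being the partial isometry with $\ker U=\ker T=\ker|T|$. The Aluthge transform of $T$ is $\widetilde{T}=|T|^{1/2}U|T|^{1/2}$. The iterated Aluthge transforms are $\widetilde{T}^{(0)}=T$ and $\widetilde{T}^{(n+1)}=\widetilde{(\widetilde{T}^{(n)})}$ for every integer $n\ge0$. *)

theory Defs
  imports "HOL-Complex_Analysis.Complex_Analysis" "HOL-Library.FuncSet"
begin

section \<open>Operators on a Hilbert space of functions\<close>

text \<open>
  A Hilbert space is given by a set \<open>H\<close> of complex-valued functions, with the pointwise
  vector space operations, and an inner product \<open>ip\<close>, linear in its first argument.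
  An operator is an extensional function on \<open>H\<close> (\<^term>\<open>undefined\<close> outside \<open>H\<close>), so that
  two operators are equal iff they agree on \<open>H\<close>; accordingly the product of
  operators \<open>S\<close> and \<open>T\<close> is \<open>compose H S T\<close>.
\<close>

type_synonym 'a operator = "('a \<Rightarrow> complex) \<Rightarrow> ('a \<Rightarrow> complex)"
type_synonym 'a iprod = "('a \<Rightarrow> complex) \<Rightarrow> ('a \<Rightarrow> complex) \<Rightarrow> complex"

definition hnorm :: "'a iprod \<Rightarrow> ('a \<Rightarrow> complex) \<Rightarrow> real" where
  "hnorm ip h = sqrt (Re (ip h h))"

definition bounded_operator :: "('a \<Rightarrow> complex) set \<Rightarrow> 'a iprod \<Rightarrow> 'a operator \<Rightarrow> bool" where
  "bounded_operator H ip T \<longleftrightarrow>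
     T \<in> H \<rightarrow>\<^sub>E H \<and>
     (\<forall>g\<in>H. \<forall>h\<in>H. T (\<lambda>x. g x + h x) = (\<lambda>x. T g x + T h x)) \<and>
     (\<forall>c. \<forall>h\<in>H. T (\<lambda>x. c * h x) = (\<lambda>x. c * T h x)) \<and>
     (\<exists>K. \<forall>h\<in>H. hnorm ip (T h) \<le> K * hnorm ip h)"

definition adjoint_op :: "('a \<Rightarrow> complex) set \<Rightarrow> 'a iprod \<Rightarrow> 'a operator \<Rightarrow> 'a operator" where
  "adjoint_op H ip T =
     (THE S. bounded_operator H ip S \<and> (\<forall>g\<in>H. \<forall>h\<in>H. ip (T g) h = ip g (S h)))"

definition positive_operator :: "('a \<Rightarrow> complex) set \<Rightarrow> 'a iprod \<Rightarrow> 'a operator \<Rightarrow> bool" where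
  "positive_operator H ip T \<longleftrightarrow>
     bounded_operator H ip T \<and> (\<forall>h\<in>H. ip (T h) h \<in> \<real>\<^sub>\<ge>\<^sub>0)"

definition sqrt_op :: "('a \<Rightarrow> complex) set \<Rightarrow> 'a iprod \<Rightarrow> 'a operator \<Rightarrow> 'a operator" where
  "sqrt_op H ip P = (THE R. positive_operator H ip R \<and> compose H R R = P)"

definition abs_op :: "('a \<Rightarrow> complex) set \<Rightarrow> 'a iprod \<Rightarrow> 'a operator \<Rightarrow> 'a operator" where
  "abs_op H ip T = sqrt_op H ip (compose H (adjoint_op H ip T) T)"

definition ker_op :: "('a \<Rightarrow> complex) set \<Rightarrow> 'a operator \<Rightarrow> ('a \<Rightarrow> complex) set" where
  "ker_op H T = {h \<in> H. T h = (\<lambda>x. 0)}"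

definition orth_compl ::
    "('a \<Rightarrow> complex) set \<Rightarrow> 'a iprod \<Rightarrow> ('a \<Rightarrow> complex) set \<Rightarrow> ('a \<Rightarrow> complex) set" where
  "orth_compl H ip K = {h \<in> H. \<forall>k\<in>K. ip h k = 0}"

definition partial_isometry :: "('a \<Rightarrow> complex) set \<Rightarrow> 'a iprod \<Rightarrow> 'a operator \<Rightarrow> bool" where
  "partial_isometry H ip U \<longleftrightarrow>
     bounded_operator H ip U \<and>
     (\<forall>h \<in> orth_compl H ip (ker_op H U). hnorm ip (U h) = hnorm ip h)"

definition polar_part :: "('a \<Rightarrow> complex) set \<Rightarrow> 'a iprod \<Rightarrow> 'a operator \<Rightarrow> 'a operator" where
  "polar_part H ip T =
     (THE U. partial_isometry H ip U \<and>
             ker_op H U = ker_op H T \<and> ker_op H U = ker_op H (abs_op H ip T) \<and>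
             T = compose H U (abs_op H ip T))"

definition aluthge :: "('a \<Rightarrow> complex) set \<Rightarrow> 'a iprod \<Rightarrow> 'a operator \<Rightarrow> 'a operator" where
  "aluthge H ip T =
     (let Q = sqrt_op H ip (abs_op H ip T)
      in compose H Q (compose H (polar_part H ip T) Q))"

primrec iterated_aluthge ::
    "('a \<Rightarrow> complex) set \<Rightarrow> 'a iprod \<Rightarrow> nat \<Rightarrow> 'a operator \<Rightarrow> 'a operator" where
  "iterated_aluthge H ip 0 T = T"
| "iterated_aluthge H ip (Suc n) T = aluthge H ip (iterated_aluthge H ip n T)"

section \<open>The weighted Bergman space of the unit disk\<close>

definition taylor_coeff :: "(complex \<Rightarrow> complex) \<Rightarrow> nat \<Rightarrow> complex" where
  "taylor_coeff h n = (deriv ^^ n) h 0 / fact n"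

definition bergman_weight :: "real \<Rightarrow> nat \<Rightarrow> real" where
  "bergman_weight \<alpha> n = fact n * Gamma (\<alpha> + 2) / Gamma (real n + \<alpha> + 2)"

text \<open>
  A function on the disk is represented by its extension by zero to the whole plane, so that
  equality of elements of the space is equality on the disk.
\<close>

definition bergman_space :: "real \<Rightarrow> (complex \<Rightarrow> complex) set" where
  "bergman_space \<alpha> =
     {h. h holomorphic_on ball 0 1 \<and> (\<forall>z. z \<notin> ball 0 1 \<longrightarrow> h z = 0) \<and>
         summable (\<lambda>n. bergman_weight \<alpha> n * (cmod (taylor_coeff h n))\<^sup>2)}"

definition bergman_inner :: "real \<Rightarrow> complex iprod" where
  "bergman_inner \<alpha> g h =
     (\<Sum>n. of_real (bergman_weight \<alpha> n) * taylor_coeff g n * cnj (taylor_coeff h n))"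

definition toeplitz_op :: "real \<Rightarrow> (complex \<Rightarrow> complex) \<Rightarrow> complex operator" where
  "toeplitz_op \<alpha> f =
     (\<lambda>h\<in>bergman_space \<alpha>. \<lambda>z. if z \<in> ball 0 1 then f z * h z else 0)"

definition composition_op :: "real \<Rightarrow> (complex \<Rightarrow> complex) \<Rightarrow> complex operator" where
  "composition_op \<alpha> \<phi> =
     (\<lambda>h\<in>bergman_space \<alpha>. \<lambda>z. if z \<in> ball 0 1 then h (\<phi> z) else 0)"

end

theory Submission
  imports Defs
begin

text \<open>
  To a real matrix with rows \<open>(p, q)\<close> and \<open>(r, s)\<close> belongs the weighted composition operator
  that maps \<open>h\<close> to \<open>(r z + s)\<close> to the power \<open>-(\<alpha> + 2)\<close> times \<open>h ((p z + q) / (r z + s))\<close>.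
  The exponent is the one of the reproducing kernel, so that all operations of the Aluthge transform
  turn into matrix algebra: products of operators are products of matrices in reversed order, and
  the adjoint belongs to the matrix with rows \<open>(p, -r)\<close> and \<open>(-q, s)\<close>.

  The map \<open>\<phi>\<close> fixes the boundary point \<open>1\<close>, that is, the vector \<open>(1, 1)\<close> is an eigenvector of
  its matrix, and this persists for every matrix that occurs. In the basis \<open>(1, 1)\<close>, \<open>(-1, 1)\<close> the
  matrices are upper triangular, with diagonal \<open>l\<close>, \<open>d\<close> and corner \<open>k\<close>. The triples \<open>(l, d, k)\<close> with
  \<open>l, d > 0\<close> and \<open>k \<ge> 0\<close> all define self-maps of the disk; they are multiplied by
  \<open>(l, d, k) (l', d', k') = (l l', d d', l k' + k d')\<close>, and the adjoint merely exchanges \<open>l\<close> and \<open>d\<close>.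
  Let \<open>T\<close> belong to \<open>(l, d, k)\<close> and put \<open>c = sqrt (l d)\<close>. Then \<open>T\<^sup>* T\<close> belongs to
  \<open>(l d, l d, 2 l k)\<close>, so \<open>|T|\<close> belongs to \<open>(c, c, l k / c)\<close>, the unitary factor to
  \<open>(l / c, d / c, 0)\<close>, and multiplying out, the Aluthge transform to
  \<open>(l, d, k (l + d) / (2 d))\<close> (lemma \<open>aluthge_wco\<close>). The operator \<open>C\<^sub>\<phi>\<close> belongs to
  \<open>(1, a, 1 - a)\<close>, so its \<open>n\<close>th iterated transform belongs to \<open>(1, a, \<kappa>)\<close> with
  \<open>\<kappa> = (1 - a) ((1 + a) / (2 a))\<^sup>n\<close>; written out, this is \<open>T\<^sub>f C\<^sub>\<psi>\<close>.

  The analysis consists in showing that these formal computations identify the operators that the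
  definitions single out.
  \<^item> Boundedness (\<open>wco_bounded_exists\<close>): the triples \<open>(l, d, 0)\<close> give multiples of isometries,
    because on monomials they are inverted by their adjoints up to a scalar; one triple with a
    nonnegative matrix is handled by the Schur test with the coefficients of
    the kernel at the fixed point \<open>1\<close>; and every triple is a product of these.
  \<^item> Adjoints (\<open>wco_adjoint\<close>): the matrix coefficients in the basis of monomials have a
    symmetric closed form (\<open>gram_swap\<close>).
  \<^item> Positive square roots are unique (\<open>positive_sqrt_unique\<close>): at a vector where the difference of two of
    them nearly attains its norm, both are small.
  \<^item> The partial isometry is unique since \<open>|T|\<close> has dense range
    (\<open>operator_eq_on_range_imp_eq\<close>): a functional vanishing on the range
    yields a power series annihilated by the adjoint, hence zero by the identity theorem.
\<close>

section \<open>Uniqueness of adjoints and of positive square roots\<close>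

locale function_inner_space =
  fixes H :: "('a \<Rightarrow> complex) set" and ip :: "'a iprod"
  assumes zero_mem: "(\<lambda>x. 0) \<in> H"
    and add_mem: "g \<in> H \<Longrightarrow> h \<in> H \<Longrightarrow> (\<lambda>x. g x + h x) \<in> H"
    and scale_mem: "h \<in> H \<Longrightarrow> (\<lambda>x. c * h x) \<in> H"
    and ip_add_left: "g \<in> H \<Longrightarrow> h \<in> H \<Longrightarrow> k \<in> H \<Longrightarrow> ip (\<lambda>x. g x + h x) k = ip g k + ip h k"
    and ip_scale_left: "h \<in> H \<Longrightarrow> k \<in> H \<Longrightarrow> ip (\<lambda>x. c * h x) k = c * ip h k"
    and ip_cnj: "g \<in> H \<Longrightarrow> h \<in> H \<Longrightarrow> cnj (ip g h) = ip h g"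
    and ip_nonneg: "h \<in> H \<Longrightarrow> 0 \<le> Re (ip h h)"
    and ip_definite: "h \<in> H \<Longrightarrow> Re (ip h h) = 0 \<Longrightarrow> h = (\<lambda>x. 0)"
begin

lemma ip_add_right: "g \<in> H \<Longrightarrow> h \<in> H \<Longrightarrow> k \<in> H \<Longrightarrow> ip k (\<lambda>x. g x + h x) = ip k g + ip k h"
  using arg_cong[OF ip_add_left[of g h k], of cnj] by (simp add: ip_cnj add_mem)

lemma ip_scale_right: "h \<in> H \<Longrightarrow> k \<in> H \<Longrightarrow> ip k (\<lambda>x. c * h x) = cnj c * ip k h"
  using arg_cong[OF ip_scale_left[of h k c], of cnj] by (simp add: ip_cnj scale_mem)

lemma diff_mem: "g \<in> H \<Longrightarrow> h \<in> H \<Longrightarrow> (\<lambda>x. g x - h x) \<in> H"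
  using add_mem[of g "\<lambda>x. (-1) * h x"] scale_mem[of h "-1"] by simp

lemma ip_diff_left:
  assumes "g \<in> H" "h \<in> H" "k \<in> H" shows "ip (\<lambda>x. g x - h x) k = ip g k - ip h k"
  using ip_add_left[OF assms(1) scale_mem[OF assms(2)] assms(3), of "-1"]
    ip_scale_left[OF assms(2,3), of "-1"] by simp

lemma ip_diff_right:
  assumes "g \<in> H" "h \<in> H" "k \<in> H" shows "ip k (\<lambda>x. g x - h x) = ip k g - ip k h"
  using ip_add_right[OF assms(1) scale_mem[OF assms(2)] assms(3), of "-1"]
    ip_scale_right[OF assms(2,3), of "-1"] by simp

lemma ip_self: "h \<in> H \<Longrightarrow> ip h h = of_real (Re (ip h h))"
  using ip_cnj[of h h] by (simp add: complex_eq_iff)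

lemma eq_if_diff_null:
  assumes "g \<in> H" "h \<in> H" "ip (\<lambda>x. g x - h x) (\<lambda>x. g x - h x) = 0" shows "g = h"
proof -
  have "(\<lambda>x. g x - h x) = (\<lambda>x. 0)"
    using assms ip_definite[OF diff_mem[OF assms(1,2)]] by simp
  then show ?thesis by (auto simp: fun_eq_iff)
qed

lemma hnorm_sq: "h \<in> H \<Longrightarrow> (hnorm ip h)\<^sup>2 = Re (ip h h)"
  by (simp add: hnorm_def ip_nonneg)

lemma hnorm_nonneg: "0 \<le> hnorm ip h" if "h \<in> H"
  by (simp add: hnorm_def ip_nonneg that)

lemma bounded_operatorD:
  assumes "bounded_operator H ip T"
  shows op_mem: "h \<in> H \<Longrightarrow> T h \<in> H"
    and op_add: "g \<in> H \<Longrightarrow> h \<in> H \<Longrightarrow> T (\<lambda>x. g x + h x) = (\<lambda>x. T g x + T h x)"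
    and op_scale: "h \<in> H \<Longrightarrow> T (\<lambda>x. c * h x) = (\<lambda>x. c * T h x)"
  using assms by (auto simp: bounded_operator_def)

lemma op_diff:
  assumes "bounded_operator H ip T" "g \<in> H" "h \<in> H"
  shows "T (\<lambda>x. g x - h x) = (\<lambda>x. T g x - T h x)"
  using op_add[OF assms(1,2) scale_mem[OF assms(3)], of "-1"] op_scale[OF assms(1,3), of "-1"]
  by simp

lemma bounded_operator_sq_bound:
  assumes "bounded_operator H ip T"
  obtains K where "K > 0" "\<And>h. h \<in> H \<Longrightarrow> Re (ip (T h) (T h)) \<le> K\<^sup>2 * Re (ip h h)"
proof -
  obtain K where K: "\<And>h. h \<in> H \<Longrightarrow> hnorm ip (T h) \<le> K * hnorm ip h"
    using assms unfolding bounded_operator_def by blast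
  have "Re (ip (T h) (T h)) \<le> (\<bar>K\<bar> + 1)\<^sup>2 * Re (ip h h)" if "h \<in> H" for h
  proof -
    have "hnorm ip (T h) \<le> (\<bar>K\<bar> + 1) * hnorm ip h"
      using K[OF that] mult_right_mono[of K "\<bar>K\<bar> + 1" "hnorm ip h"] hnorm_nonneg[OF that] by linarith
    then have "(hnorm ip (T h))\<^sup>2 \<le> ((\<bar>K\<bar> + 1) * hnorm ip h)\<^sup>2"
      using hnorm_nonneg[OF op_mem[OF assms that]] by (intro power_mono)
    then show ?thesis using that op_mem[OF assms that] by (simp add: power_mult_distrib hnorm_sq)
  qed
  then show ?thesis by (intro that[of "\<bar>K\<bar> + 1"]) auto
qed

lemma bounded_operator_eqI:
  assumes "bounded_operator H ip S" "bounded_operator H ip T" "\<And>h. h \<in> H \<Longrightarrow> S h = T h"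
  shows "S = T"
proof (rule PiE_ext)
  show "S \<in> H \<rightarrow>\<^sub>E H" "T \<in> H \<rightarrow>\<^sub>E H" using assms(1,2) by (simp_all add: bounded_operator_def)
qed (rule assms(3))

lemma adjoint_op_eqI:
  assumes "bounded_operator H ip S" "\<And>g h. g \<in> H \<Longrightarrow> h \<in> H \<Longrightarrow> ip (T g) h = ip g (S h)"
  shows "adjoint_op H ip T = S"
  unfolding adjoint_op_def
proof (rule the_equality)
  show "bounded_operator H ip S \<and> (\<forall>g\<in>H. \<forall>h\<in>H. ip (T g) h = ip g (S h))" using assms by blast
  fix S' assume S': "bounded_operator H ip S' \<and> (\<forall>g\<in>H. \<forall>h\<in>H. ip (T g) h = ip g (S' h))"
  show "S' = S"
  proof (rule bounded_operator_eqI)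
    fix h assume h: "h \<in> H"
    have mem: "S' h \<in> H" "S h \<in> H" using S' assms(1) h op_mem by blast+
    have eq: "ip g (S' h) = ip g (S h)" if "g \<in> H" for g using that S' assms(2) h by metis
    show "S' h = S h"
      using eq[OF diff_mem[OF mem]] mem diff_mem[OF mem]
      by (intro eq_if_diff_null) (auto simp: ip_diff_right)
  qed (use S' assms in auto)
qed

text \<open>
  The form \<open>ip (T g) h\<close> need not be definite, so the discriminant of the quadratic
  polynomial \<open>t \<Rightarrow> ip (T (g + t h)) (g + t h)\<close> is used, with the case of a vanishing leading
  coefficient apart.
\<close>

lemma semidefinite_Cauchy_Schwarz:
  assumes B: "bounded_operator H ip T" and pos: "\<And>h. h \<in> H \<Longrightarrow> 0 \<le> Re (ip (T h) h)"
    and sym: "\<And>g h. g \<in> H \<Longrightarrow> h \<in> H \<Longrightarrow> ip (T g) h = ip g (T h)"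
    and g: "g \<in> H" and h: "h \<in> H"
  shows "(Re (ip (T g) h))\<^sup>2 \<le> Re (ip (T g) g) * Re (ip (T h) h)"
proof -
  define p q m where "p = Re (ip (T g) g)" "q = Re (ip (T h) h)" "m = Re (ip (T g) h)"
  note mem = g h op_mem[OF B g] op_mem[OF B h]
  have flip: "Re (ip (T h) g) = m"
    using sym[OF h g] ip_cnj[OF mem(3) h] by (simp add: p_q_m_def complex_eq_iff)
  have quad: "0 \<le> p + 2 * t * m + t\<^sup>2 * q" for t :: real
  proof -
    define v where "v = (\<lambda>x. g x + of_real t * h x)"
    have "T v = (\<lambda>x. T g x + of_real t * T h x)"
      unfolding v_def using op_add[OF B g scale_mem[OF h]] op_scale[OF B h] by simp
    then have "ip (T v) v = ip (T g) g + of_real t * ip (T g) h + of_real t * ip (T h) g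
                + of_real (t\<^sup>2) * ip (T h) h"
      unfolding v_def using mem
      by (simp add: ip_add_left ip_add_right ip_scale_left ip_scale_right add_mem scale_mem
          power2_eq_square algebra_simps)
    moreover have "0 \<le> Re (ip (T v) v)" unfolding v_def using g h by (intro pos add_mem scale_mem)
    ultimately show ?thesis by (simp add: p_q_m_def[symmetric] flip algebra_simps)
  qed
  have "p \<ge> 0" "q \<ge> 0" using pos g h by (auto simp: p_q_m_def)
  have "m\<^sup>2 \<le> p * q"
  proof (cases "q = 0")
    case True
    have "m = 0"
    proof (rule ccontr)
      assume "m \<noteq> 0"
      then show False using quad[of "- (p + 1) / (2 * m)"] True by (simp add: field_simps)
    qed
    then show ?thesis by (simp add: True)
  next
    case False
    then have "q > 0" using \<open>q \<ge> 0\<close> by simp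
    have "0 \<le> q * (p + 2 * (- m / q) * m + (- m / q)\<^sup>2 * q)" using \<open>q > 0\<close> by (intro mult_nonneg_nonneg quad) simp
    also have "\<dots> = p * q - m\<^sup>2" using \<open>q > 0\<close> by (simp add: field_simps power2_eq_square)
    finally show ?thesis by simp
  qed
  then show ?thesis by (simp add: p_q_m_def)
qed

lemma bounded_operator_id: "bounded_operator H ip (\<lambda>h\<in>H. h)"
  by (auto simp: bounded_operator_def add_mem scale_mem intro: exI[of _ 1])

lemma Cauchy_Schwarz:
  assumes "g \<in> H" "h \<in> H" shows "(Re (ip g h))\<^sup>2 \<le> Re (ip g g) * Re (ip h h)"
  using semidefinite_Cauchy_Schwarz[OF bounded_operator_id, of g h] assms ip_nonneg by simp

text \<open>
  The bound for the real part, applied to \<open>u g\<close> with the phase \<open>u\<close> that makes \<open>ip (u g) h\<close> real.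
\<close>

lemma norm_ip_le:
  assumes "g \<in> H" "h \<in> H" shows "cmod (ip g h) \<le> hnorm ip g * hnorm ip h"
proof -
  define u where "u = cnj (sgn (ip g h))"
  have u: "u * ip g h = of_real (cmod (ip g h))"
    unfolding u_def by (cases "ip g h = 0")
      (simp_all add: sgn_div_norm scaleR_conv_of_real complex_norm_square[symmetric] power2_eq_square
        mult.commute[of "cnj _"] field_simps)
  have n: "u * cnj u * c = c" if "ip g h \<noteq> 0" for c
    unfolding complex_norm_square[symmetric] using that by (simp add: u_def norm_sgn)
  show ?thesis
  proof (cases "ip g h = 0")
    case True
    then show ?thesis using hnorm_nonneg assms by simp
  next
    case False
    have "(cmod (ip g h))\<^sup>2 = (Re (ip (\<lambda>x. u * g x) h))\<^sup>2" using assms by (simp add: ip_scale_left u)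
    also have "\<dots> \<le> Re (ip (\<lambda>x. u * g x) (\<lambda>x. u * g x)) * Re (ip h h)"
      using assms by (intro Cauchy_Schwarz scale_mem)
    also have "ip (\<lambda>x. u * g x) (\<lambda>x. u * g x) = ip g g"
      using assms n[OF False] by (simp add: ip_scale_left ip_scale_right scale_mem mult.assoc[symmetric])
    finally show ?thesis by (simp add: hnorm_def real_le_rsqrt flip: real_sqrt_mult)
  qed
qed

lemma positive_operatorD:
  assumes "positive_operator H ip R"
  shows positive_operator_bounded: "bounded_operator H ip R"
    and positive_operator_nonneg: "h \<in> H \<Longrightarrow> 0 \<le> Re (ip (R h) h)"
    and positive_operator_real: "h \<in> H \<Longrightarrow> Im (ip (R h) h) = 0"
  using assms unfolding positive_operator_def
  by (auto simp: complex_nonneg_Reals_iff)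

text \<open>
  Polarisation: the quadratic form is real at \<open>g + h\<close> and at \<open>g + \<i> h\<close>.
\<close>

lemma positive_operator_sym:
  assumes R: "positive_operator H ip R" and g: "g \<in> H" and h: "h \<in> H"
  shows "ip (R g) h = ip g (R h)"
proof -
  note B = positive_operator_bounded[OF R]
  note mem = g h op_mem[OF B g] op_mem[OF B h]
  have im: "Im (ip (R (\<lambda>x. g x + c * h x)) (\<lambda>x. g x + c * h x)) = 0" for c
    by (rule positive_operator_real[OF R]) (intro add_mem scale_mem g h)
  have "ip (R (\<lambda>x. g x + c * h x)) (\<lambda>x. g x + c * h x)
        = ip (R g) g + cnj c * ip (R g) h + c * ip (R h) g + c * cnj c * ip (R h) h" for c
    using mem op_add[OF B g scale_mem[OF h], of c] op_scale[OF B h, of c]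
    by (simp add: ip_add_left ip_add_right ip_scale_left ip_scale_right add_mem scale_mem
        algebra_simps)
  from im[unfolded this, of 1] im[unfolded this, of \<i>]
  have "Im (ip (R g) h) + Im (ip (R h) g) = 0" "Re (ip (R h) g) = Re (ip (R g) h)"
    using positive_operator_real[OF R g] positive_operator_real[OF R h] by simp_all
  moreover have "ip g (R h) = cnj (ip (R h) g)" using ip_cnj mem by simp
  ultimately show ?thesis by (simp add: complex_eq_iff)
qed

text \<open>
  If \<open>ip (R h) h\<close> is small then so is \<open>R h\<close>: Cauchy--Schwarz for the form of \<open>R\<close>, at \<open>h\<close> and \<open>R h\<close>.
\<close>

lemma positive_operator_image_bound:
  assumes R: "positive_operator H ip R"
    and K: "K > 0" "\<And>h. h \<in> H \<Longrightarrow> Re (ip (R h) (R h)) \<le> K\<^sup>2 * Re (ip h h)" and h: "h \<in> H"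
  shows "Re (ip (R h) (R h)) \<le> K * Re (ip (R h) h)"
proof -
  note B = positive_operator_bounded[OF R]
  define u where "u = Re (ip (R h) (R h))"
  have m: "R h \<in> H" "R (R h) \<in> H" using op_mem[OF B] h by auto
  have u0: "u \<ge> 0" using ip_nonneg m by (simp add: u_def)
  have "(Re (ip (R (R h)) (R h)))\<^sup>2 \<le> Re (ip (R (R h)) (R (R h))) * u"
    unfolding u_def using Cauchy_Schwarz m by auto
  also have "\<dots> \<le> K\<^sup>2 * u * u" using K(2)[OF m(1)] u0 by (intro mult_right_mono) (auto simp: u_def)
  finally have "(Re (ip (R (R h)) (R h)))\<^sup>2 \<le> (K * u)\<^sup>2" by (simp add: power2_eq_square mult_ac)
  then have 1: "Re (ip (R (R h)) (R h)) \<le> K * u"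
    using K u0 by (meson power2_le_imp_le mult_nonneg_nonneg less_imp_le)
  have "u\<^sup>2 \<le> Re (ip (R h) h) * Re (ip (R (R h)) (R h))"
    unfolding u_def
    using semidefinite_Cauchy_Schwarz[OF B positive_operator_nonneg[OF R] positive_operator_sym[OF R] h m(1)]
    by simp
  also have "\<dots> \<le> Re (ip (R h) h) * (K * u)"
    using 1 positive_operator_nonneg[OF R h] by (intro mult_left_mono)
  finally have "u * u \<le> (K * Re (ip (R h) h)) * u" by (simp add: power2_eq_square mult_ac)
  then show ?thesis
    using u0 K positive_operator_nonneg[OF R h] unfolding u_def[symmetric]
    by (cases "u = 0") (auto dest: mult_right_le_imp_le)
qed

text \<open>
  The key step towards uniqueness of the square root. For \<open>D = R - S\<close> and \<open>A = R + S\<close> the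
  hypothesis \<open>R\<^sup>2 = S\<^sup>2\<close> says that \<open>D A + A D = 0\<close>. If \<open>c\<close> bounds the squared norm of \<open>D\<close> and is almost
  attained at \<open>h\<close>, then \<open>D\<^sup>2 h\<close> is close to \<open>c h\<close>; as
  \<open>ip (A D\<^sup>2 h) h = - ip (A D h) (D h) \<le> 0\<close>, the nonnegative number \<open>c ip (A h) h\<close> is
  almost nonpositive. Hence \<open>ip (R h) h\<close> and \<open>ip (S h) h\<close> are small, and so are \<open>R h\<close>,
  \<open>S h\<close> and \<open>D h\<close>. The parameter \<open>t\<close> measures how nearly the norm is attained.
\<close>

lemma positive_sqrt_near_maximal:
  assumes R: "positive_operator H ip R" and S: "positive_operator H ip S"
    and eq: "\<And>h. h \<in> H \<Longrightarrow> R (R h) = S (S h)"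
    and K: "K > 0" "\<And>h. h \<in> H \<Longrightarrow> Re (ip (R h) (R h)) \<le> K\<^sup>2 * Re (ip h h)"
       "\<And>h. h \<in> H \<Longrightarrow> Re (ip (S h) (S h)) \<le> K\<^sup>2 * Re (ip h h)"
    and D: "\<And>h. D h = (\<lambda>x. R h x - S h x)"
    and c: "c > 0" "\<And>h. h \<in> H \<Longrightarrow> Re (ip (D h) (D h)) \<le> c * Re (ip h h)"
    and t: "t \<ge> 0" and h: "h \<in> H" and near: "Re (ip (D h) (D h)) \<ge> (c - c * t\<^sup>2) * Re (ip h h)"
  shows "Re (ip (D h) (D h)) \<le> 4 * K\<^sup>2 * t * Re (ip h h)"
proof -
  note BR = positive_operator_bounded[OF R] and BS = positive_operator_bounded[OF S]
  define A where "A g = (\<lambda>x. R g x + S g x)" for g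
  define N where "N g = Re (ip g g)" for g
  have DH: "D g \<in> H" if "g \<in> H" for g unfolding D using that op_mem[OF BR] op_mem[OF BS] diff_mem by simp
  have AH: "A g \<in> H" if "g \<in> H" for g unfolding A_def using that op_mem[OF BR] op_mem[OF BS] add_mem by simp
  have Dsym: "ip (D g) k = ip g (D k)" if "g \<in> H" "k \<in> H" for g k
    using that op_mem[OF BR] op_mem[OF BS] positive_operator_sym[OF R] positive_operator_sym[OF S]
    by (simp add: D ip_diff_left ip_diff_right)
  have Asym: "ip (A g) k = ip g (A k)" if "g \<in> H" "k \<in> H" for g k
    using that op_mem[OF BR] op_mem[OF BS] positive_operator_sym[OF R] positive_operator_sym[OF S]
    by (simp add: A_def ip_add_left ip_add_right)
  have anti: "D (A g) = (\<lambda>x. - A (D g) x)" if "g \<in> H" for g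
  proof -
    note m = op_mem[OF BR that] op_mem[OF BS that]
    show ?thesis
      unfolding A_def D using eq[OF that] m op_add[OF BR] op_add[OF BS] op_diff[OF BR] op_diff[OF BS]
      by (auto simp: fun_eq_iff)
  qed
  \<comment> \<open>The error of \<open>h\<close> as an eigenvector of \<open>D\<^sup>2\<close>; its norm is at most \<open>c t\<close> times that of \<open>h\<close>.\<close>
  define y where "y = (\<lambda>x. D (D h) x - of_real c * h x)"
  have mem: "D h \<in> H" "D (D h) \<in> H" "y \<in> H" "A h \<in> H" "A (D h) \<in> H"
    unfolding y_def by (auto intro!: DH AH h diff_mem scale_mem)
  have "ip y y = ip (D (D h)) (D (D h)) - of_real c * ip h (D (D h)) - of_real c * ip (D (D h)) h
           + of_real (c\<^sup>2) * ip h h"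
    unfolding y_def using mem h
    by (simp add: ip_diff_left ip_diff_right diff_mem scale_mem ip_scale_left ip_scale_right
        power2_eq_square algebra_simps)
  also have "ip h (D (D h)) = ip (D h) (D h)" using Dsym h mem by simp
  also have "ip (D (D h)) h = ip (D h) (D h)" using Dsym h mem by simp
  finally have "N y = N (D (D h)) - 2 * c * N (D h) + c\<^sup>2 * N h" by (simp add: N_def)
  also have "\<dots> \<le> c * N (D h) - 2 * c * N (D h) + c\<^sup>2 * N h" using c(2)[OF mem(1)] by (simp add: N_def)
  also have "\<dots> = c * (c * N h - N (D h))" by (simp add: algebra_simps power2_eq_square)
  also have "\<dots> \<le> c * (c * t\<^sup>2 * N h)" using near c by (intro mult_left_mono) (auto simp: N_def algebra_simps)
  finally have Ny: "N y \<le> (c * t)\<^sup>2 * N h" by (simp add: power2_eq_square algebra_simps)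
  have NA: "N (A h) \<le> (2 * K)\<^sup>2 * N h"
  proof -
    have m: "R h \<in> H" "S h \<in> H" using h op_mem BR BS by auto
    have "N (A h) + N (D h) = 2 * N (R h) + 2 * N (S h)"
      unfolding N_def A_def D using m
      by (simp add: ip_diff_left ip_diff_right ip_add_left ip_add_right add_mem diff_mem)
    moreover have "N (D h) \<ge> 0" unfolding N_def using mem ip_nonneg by simp
    ultimately show ?thesis using K(2,3)[OF h] by (simp add: N_def power2_eq_square)
  qed
  have pos: "0 \<le> Re (ip (A g) g)" if "g \<in> H" for g
    using that positive_operator_nonneg[OF R that] positive_operator_nonneg[OF S that] op_mem[OF BR that] op_mem[OF BS that]
    by (simp add: A_def ip_add_left)
  have Nh: "N h \<ge> 0" unfolding N_def using ip_nonneg h by simp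
  have "ip (D (D h)) (A h) = ip (D h) (D (A h))" using Dsym mem by simp
  also have "\<dots> = - ip (D h) (A (D h))"
    using anti[OF h] ip_scale_right[OF mem(5,1), of "-1"] by simp
  finally have "Re (ip (D (D h)) (A h)) \<le> 0" using pos[OF mem(1)] Asym[OF mem(1) mem(1)] by simp
  moreover have "ip (D (D h)) (A h) = ip y (A h) + of_real c * ip (A h) h"
    unfolding y_def using mem h Asym by (simp add: ip_diff_left ip_scale_left scale_mem)
  ultimately have "c * Re (ip (A h) h) \<le> - Re (ip y (A h))" by simp
  also have "\<dots> \<le> (c * t) * (2 * K) * N h"
  proof -
    have "(Re (ip y (A h)))\<^sup>2 \<le> N y * N (A h)" using Cauchy_Schwarz mem by (simp add: N_def)
    also have "\<dots> \<le> ((c * t)\<^sup>2 * N h) * ((2 * K)\<^sup>2 * N h)"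
      using Ny NA ip_nonneg mem Nh by (intro mult_mono) (auto simp: N_def)
    finally have "(- Re (ip y (A h)))\<^sup>2 \<le> ((c * t) * (2 * K) * N h)\<^sup>2"
      by (simp add: power2_eq_square algebra_simps)
    then show ?thesis using c t K Nh
      by (meson power2_le_imp_le mult_nonneg_nonneg less_imp_le zero_le_numeral)
  qed
  finally have "c * Re (ip (A h) h) \<le> c * (2 * K * t * N h)" by (simp add: mult_ac)
  then have Ah: "Re (ip (A h) h) \<le> 2 * K * t * N h" using c by simp
  have m: "R h \<in> H" "S h \<in> H" using h op_mem BR BS by auto
  have "N (D h) + N (A h) = 2 * N (R h) + 2 * N (S h)"
      unfolding N_def A_def D using m
      by (simp add: ip_diff_left ip_diff_right ip_add_left ip_add_right add_mem diff_mem)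
  moreover have "N (A h) \<ge> 0" unfolding N_def using mem ip_nonneg by simp
  ultimately have "N (D h) \<le> 2 * N (R h) + 2 * N (S h)" by simp
  also have "\<dots> \<le> 2 * K * Re (ip (A h) h)"
    using positive_operator_image_bound[OF R K(1,2) h] positive_operator_image_bound[OF S K(1,3) h] m h
    by (simp add: N_def A_def ip_add_left algebra_simps)
  also have "\<dots> \<le> 2 * K * (2 * K * t * N h)" using Ah K by simp
  finally show ?thesis by (simp add: N_def power2_eq_square mult_ac)
qed

text \<open>
  With \<open>c\<close> the best constant in \<open>\<parallel>D h\<parallel>\<^sup>2 \<le> c \<parallel>h\<parallel>\<^sup>2\<close> for \<open>D = R - S\<close>, vectors at which \<open>c\<close> is nearly
  attained exist; the preceding estimate bounds \<open>D\<close> there by an arbitrarily small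
  multiple, which is absurd unless \<open>c = 0\<close>.
\<close>

lemma positive_sqrt_unique:
  assumes R: "positive_operator H ip R" and S: "positive_operator H ip S"
    and eq: "\<And>h. h \<in> H \<Longrightarrow> R (R h) = S (S h)"
  shows "R = S"
proof -
  note BR = positive_operator_bounded[OF R] and BS = positive_operator_bounded[OF S]
  obtain K1 where K1: "K1 > 0" "\<And>h. h \<in> H \<Longrightarrow> Re (ip (R h) (R h)) \<le> K1\<^sup>2 * Re (ip h h)"
    using bounded_operator_sq_bound[OF BR] by blast
  obtain K2 where K2: "K2 > 0" "\<And>h. h \<in> H \<Longrightarrow> Re (ip (S h) (S h)) \<le> K2\<^sup>2 * Re (ip h h)"
    using bounded_operator_sq_bound[OF BS] by blast
  define K where "K = max K1 K2"
  have K: "K > 0" "\<And>h. h \<in> H \<Longrightarrow> Re (ip (R h) (R h)) \<le> K\<^sup>2 * Re (ip h h)"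
       "\<And>h. h \<in> H \<Longrightarrow> Re (ip (S h) (S h)) \<le> K\<^sup>2 * Re (ip h h)"
    using K1 K2 unfolding K_def
    by (auto intro!: order.trans[OF K1(2)] order.trans[OF K2(2)] mult_right_mono power_mono ip_nonneg)
  define D where "D h = (\<lambda>x. R h x - S h x)" for h
  have DH: "D g \<in> H" if "g \<in> H" for g unfolding D_def using that op_mem[OF BR] op_mem[OF BS] diff_mem by simp
  define C where "C = {c. c \<ge> 0 \<and> (\<forall>h\<in>H. Re (ip (D h) (D h)) \<le> c * Re (ip h h))}"
  define c where "c = Inf C"
  have "Re (ip (D h) (D h)) \<le> 4 * K\<^sup>2 * Re (ip h h)" if "h \<in> H" for h
  proof -
    have m: "R h \<in> H" "S h \<in> H" using that op_mem BR BS by auto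
    have "Re (ip (D h) (D h)) + Re (ip (\<lambda>x. R h x + S h x) (\<lambda>x. R h x + S h x))
           = 2 * Re (ip (R h) (R h)) + 2 * Re (ip (S h) (S h))"
      unfolding D_def using m
      by (simp add: ip_diff_left ip_diff_right ip_add_left ip_add_right add_mem diff_mem)
    moreover have "0 \<le> Re (ip (\<lambda>x. R h x + S h x) (\<lambda>x. R h x + S h x))"
      using m by (intro ip_nonneg add_mem)
    ultimately show ?thesis using K(2,3)[OF that] by simp
  qed
  then have ne: "C \<noteq> {}" unfolding C_def using zero_le_power2[of K] by (auto intro!: exI[of _ "4 * K\<^sup>2"])
  have bdd: "bdd_below C" unfolding C_def by (auto intro!: bdd_belowI[of _ 0])
  have c0: "c \<ge> 0" unfolding c_def using ne by (intro cInf_greatest) (auto simp: C_def)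
  have cb: "Re (ip (D h) (D h)) \<le> c * Re (ip h h)" if h: "h \<in> H" for h
  proof (cases "Re (ip h h) = 0")
    case True
    then show ?thesis using ne h unfolding C_def by force
  next
    case False
    then have p: "Re (ip h h) > 0" using ip_nonneg[OF h] by simp
    have "Re (ip (D h) (D h)) / Re (ip h h) \<le> c"
      unfolding c_def using ne p h by (intro cInf_greatest) (auto simp: C_def field_simps)
    then show ?thesis using p by (simp add: field_simps)
  qed
  have "c = 0"
  proof (rule ccontr)
    assume "c \<noteq> 0"
    then have c: "c > 0" using c0 by simp
    \<comment> \<open>Small enough that the upper bound \<open>4 K\<^sup>2 t \<le> c / 4\<close> contradicts the lower bound \<open>c (1 - t\<^sup>2) \<ge> 3 c / 4\<close>.\<close>
    define t where "t = min (1/2) (c / (16 * K\<^sup>2))"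
    have t: "t > 0" "t \<le> 1/2" "4 * K\<^sup>2 * t \<le> c / 4"
    proof -
      have "t \<le> c / (16 * K\<^sup>2)" by (simp add: t_def)
      then show "4 * K\<^sup>2 * t \<le> c / 4" using K by (simp add: field_simps)
    qed (use c K in \<open>auto simp: t_def\<close>)
    have "t\<^sup>2 \<le> (1/2)\<^sup>2" using t by (intro power_mono) auto
    then have t2: "t\<^sup>2 \<le> 1/4" by (simp add: power2_eq_square)
    have "c - c * t\<^sup>2 \<notin> C"
    proof
      assume "c - c * t\<^sup>2 \<in> C"
      then have "c \<le> c - c * t\<^sup>2" unfolding c_def using bdd by (intro cInf_lower)
      then show False using mult_pos_pos[OF c, of "t\<^sup>2"] t by simp
    qed
    moreover have "c - c * t\<^sup>2 \<ge> 0" using c t2 mult_left_mono[OF t2, of c] by simp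
    ultimately obtain h where h: "h \<in> H" "Re (ip (D h) (D h)) > (c - c * t\<^sup>2) * Re (ip h h)"
      by (auto simp: C_def not_le)
    have "Re (ip (D h) (D h)) \<le> 4 * K\<^sup>2 * t * Re (ip h h)"
      using h t c by (intro positive_sqrt_near_maximal[OF R S eq K D_def c cb]) auto
    also have "\<dots> \<le> c / 4 * Re (ip h h)" using t ip_nonneg[OF h(1)] by (intro mult_right_mono) auto
    also have "\<dots> \<le> (c - c * t\<^sup>2) * Re (ip h h)"
      using c mult_left_mono[OF t2, of c] ip_nonneg[OF h(1)] by (intro mult_right_mono) auto
    finally show False using h by simp
  qed
  have "R h = S h" if h: "h \<in> H" for h
  proof (rule eq_if_diff_null)
    have "Re (ip (D h) (D h)) = 0" using cb[OF h] \<open>c = 0\<close> ip_nonneg[OF DH[OF h]] by simp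
    then show "ip (\<lambda>x. R h x - S h x) (\<lambda>x. R h x - S h x) = 0"
      using ip_self[OF DH[OF h]] by (simp add: D_def)
  qed (use op_mem BR BS h in auto)
  then show ?thesis using BR BS by (rule bounded_operator_eqI[rotated 2])
qed

lemma sqrt_op_eqI:
  assumes R: "positive_operator H ip R" and eq: "compose H R R = P"
  shows "sqrt_op H ip P = R"
  unfolding sqrt_op_def
proof (rule the_equality)
  show "positive_operator H ip R \<and> compose H R R = P" using assms by simp
  fix R' assume R': "positive_operator H ip R' \<and> compose H R' R' = P"
  have "R' (R' h) = R (R h)" if "h \<in> H" for h
    using R' eq that by (metis compose_eq)
  then show "R' = R" using R R' by (intro positive_sqrt_unique) auto
qed

end

section \<open>Taylor coefficients\<close>

lemma taylor_coeff_sums: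
  assumes "f holomorphic_on ball 0 r" "z \<in> ball 0 r"
  shows "(\<lambda>n. taylor_coeff f n * z ^ n) sums f z"
  using holomorphic_power_series[OF assms] by (simp add: taylor_coeff_def)

lemma has_fps_expansion_taylor_coeff:
  assumes "f holomorphic_on ball 0 r" "r > 0"
  shows "f has_fps_expansion Abs_fps (taylor_coeff f)"
proof -
  have "Abs_fps (taylor_coeff f) = fps_expansion f 0"
    by (simp add: fps_eq_iff fps_expansion_def taylor_coeff_def)
  moreover have "f has_fps_expansion fps_expansion f 0"
    using assms by (intro has_fps_expansion_fps_expansion[of "ball 0 r"]) auto
  ultimately show ?thesis by simp
qed

lemma taylor_coeff_fps:
  assumes "f has_fps_expansion F" shows "taylor_coeff f n = fps_nth F n"
  using fps_nth_fps_expansion[OF assms] by (simp add: taylor_coeff_def)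

lemma taylor_coeff_eqI:
  assumes "r > 0" and sums: "\<And>z. z \<in> ball 0 r \<Longrightarrow> (\<lambda>n. c n * z ^ n) sums f z"
  shows "taylor_coeff f n = c n"
proof -
  have "conv_radius c \<ge> ereal r"
  proof (rule conv_radius_geI_ex)
    fix r' assume "0 < r'" "ereal r' < ereal r"
    then show "\<exists>z. norm z = r' \<and> summable (\<lambda>n. c n * z ^ n)"
      using sums_summable[OF sums[of "of_real r'"]] by (intro exI[of _ "of_real r'"]) auto
  qed
  then have rad: "fps_conv_radius (Abs_fps c) \<ge> ereal r" by (simp add: fps_conv_radius_def)
  have "f has_fps_expansion Abs_fps c"
    unfolding has_fps_expansion_def
  proof
    show "fps_conv_radius (Abs_fps c) > 0"
      using rad \<open>r > 0\<close> by (metis ereal_less(2) less_le_trans)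
    have "eventually (\<lambda>z. z \<in> ball 0 r) (nhds 0)"
      using \<open>r > 0\<close> by (intro eventually_nhds_in_open) auto
    then show "\<forall>\<^sub>F z in nhds 0. eval_fps (Abs_fps c) z = f z"
    proof eventually_elim
      case (elim z)
      then show ?case using sums_unique[OF sums[OF elim]] by (simp add: eval_fps_def)
    qed
  qed
  then show ?thesis by (simp add: taylor_coeff_fps)
qed

lemma taylor_coeff_cong:
  assumes "r > 0" "\<And>z. z \<in> ball 0 r \<Longrightarrow> f z = g z"
  shows "taylor_coeff f n = taylor_coeff g n"
proof -
  have "eventually (\<lambda>z. z \<in> ball 0 r) (nhds (0::complex))"
    using \<open>r > 0\<close> by (intro eventually_nhds_in_open) auto
  then have "eventually (\<lambda>z. f z = g z) (nhds 0)"
    by eventually_elim (rule assms(2))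
  then show ?thesis unfolding taylor_coeff_def by (simp add: higher_deriv_cong_ev)
qed

lemma taylor_coeff_add:
  assumes "f holomorphic_on ball 0 r" "g holomorphic_on ball 0 r" "r > 0"
  shows "taylor_coeff (\<lambda>z. f z + g z) n = taylor_coeff f n + taylor_coeff g n"
  using taylor_coeff_fps[OF has_fps_expansion_add[OF has_fps_expansion_taylor_coeff
        has_fps_expansion_taylor_coeff]] assms by simp

lemma taylor_coeff_scale:
  assumes "f holomorphic_on ball 0 r" "r > 0"
  shows "taylor_coeff (\<lambda>z. c * f z) n = c * taylor_coeff f n"
  using taylor_coeff_fps[OF has_fps_expansion_cmult_left[OF has_fps_expansion_taylor_coeff]] assms
  by simp

lemma taylor_coeff_mult:
  assumes "f holomorphic_on ball 0 r" "g holomorphic_on ball 0 r" "r > 0"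
  shows "taylor_coeff (\<lambda>z. f z * g z) n = (\<Sum>i\<le>n. taylor_coeff f i * taylor_coeff g (n - i))"
  using taylor_coeff_fps[OF has_fps_expansion_mult[OF has_fps_expansion_taylor_coeff
        has_fps_expansion_taylor_coeff]] assms
  by (simp add: fps_mult_nth atMost_atLeast0)

lemma summable_norm_taylor_coeff:
  assumes "g holomorphic_on ball 0 R" "R > 1"
  shows "summable (\<lambda>n. cmod (taylor_coeff g n))"
proof -
  define \<rho> where "\<rho> = (1 + R) / 2"
  have "1 < \<rho>" "\<rho> < R" using assms(2) by (auto simp: \<rho>_def)
  then have "complex_of_real \<rho> \<in> ball 0 R" "1 < \<rho>" by auto
  then have "summable (\<lambda>n. norm (taylor_coeff g n * 1 ^ n))"
    by (intro powser_insidea[OF sums_summable[OF taylor_coeff_sums[OF assms(1), of "of_real \<rho>"]]]) auto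
  then show ?thesis by simp
qed

text \<open>
  Elements of the Bergman space vanish off the disk; this normalisation brings a function into that form.
\<close>

definition on_disk :: "(complex \<Rightarrow> complex) \<Rightarrow> complex \<Rightarrow> complex" where
  "on_disk f = (\<lambda>z. if z \<in> ball 0 1 then f z else 0)"

lemma on_disk_outside: "z \<notin> ball 0 1 \<Longrightarrow> on_disk f z = 0"
  by (simp add: on_disk_def)

lemma on_disk_inside: "z \<in> ball 0 1 \<Longrightarrow> on_disk f z = f z"
  by (simp add: on_disk_def)

lemma taylor_coeff_on_disk: "taylor_coeff (on_disk f) n = taylor_coeff f n"
  by (rule taylor_coeff_cong[of 1]) (auto simp: on_disk_def)

lemma holomorphic_on_disk_iff: "on_disk f holomorphic_on ball 0 1 \<longleftrightarrow> f holomorphic_on ball 0 1"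
  by (intro holomorphic_cong) (auto simp: on_disk_def)

lemma eq_if_taylor_coeff_eq:
  assumes "f holomorphic_on ball 0 1" "g holomorphic_on ball 0 1"
    and "\<And>z. z \<notin> ball 0 1 \<Longrightarrow> f z = 0" "\<And>z. z \<notin> ball 0 1 \<Longrightarrow> g z = 0"
    and "\<And>n. taylor_coeff f n = taylor_coeff g n"
  shows "f = g"
proof
  fix z
  show "f z = g z"
  proof (cases "z \<in> ball 0 1")
    case True
    then show ?thesis
      using taylor_coeff_sums[OF assms(1) True] taylor_coeff_sums[OF assms(2) True] assms(5)
      by (simp add: sums_unique2)
  qed (use assms(3,4) in simp)
qed

lemma taylor_coeff_power: "taylor_coeff (\<lambda>z. z ^ n) m = (if m = n then 1 else 0)"
proof (rule taylor_coeff_eqI[of 1])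
  fix z :: complex
  show "(\<lambda>m. (if m = n then 1 else 0) * z ^ m) sums z ^ n"
    using sums_single[of n "\<lambda>m. z ^ m"] by (simp add: if_distrib[of "\<lambda>c. c * _"] cong: if_cong)
qed simp

section \<open>The weighted Bergman space\<close>

locale bergman =
  fixes \<alpha> :: real
  assumes \<alpha>: "\<alpha> > -1"
begin

abbreviation wt :: "nat \<Rightarrow> real" where "wt \<equiv> bergman_weight \<alpha>"
abbreviation H :: "(complex \<Rightarrow> complex) set" where "H \<equiv> bergman_space \<alpha>"
abbreviation ip :: "complex iprod" where "ip \<equiv> bergman_inner \<alpha>"

lemma wt_pochhammer: "wt n = fact n / pochhammer (\<alpha> + 2) n"
proof -
  have "\<alpha> + 2 \<notin> \<int>\<^sub>\<le>\<^sub>0" using \<alpha> by (auto elim!: nonpos_Ints_cases)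
  then have "pochhammer (\<alpha> + 2) n = Gamma (\<alpha> + 2 + of_nat n) / Gamma (\<alpha> + 2)"
    by (rule pochhammer_Gamma)
  then show ?thesis by (simp add: bergman_weight_def add_ac)
qed

lemma wt_pos: "0 < wt n"
  using \<alpha> by (simp add: wt_pochhammer pochhammer_pos)

lemma inverse_wt: "1 / wt n = pochhammer (\<alpha> + 2) n / fact n"
  by (simp add: wt_pochhammer)

lemma wt_antimono: "wt (m + k) \<le> wt m"
proof (induction k)
  case (Suc k)
  have p: "pochhammer (\<alpha> + 2) (m + k) > 0" using \<alpha> by (intro pochhammer_pos) simp
  have "wt (m + Suc k) = wt (m + k) * ((1 + real (m + k)) / (\<alpha> + 2 + real (m + k)))"
    by (simp add: wt_pochhammer pochhammer_Suc)
  also have "\<dots> \<le> wt (m + k) * 1"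
    using \<alpha> by (intro mult_left_mono less_imp_le[OF wt_pos]) (simp add: field_simps)
  finally show ?case using Suc by simp
qed simp

lemma wt_le_one: "wt n \<le> 1"
  using wt_antimono[of 0 n] by (simp add: wt_pochhammer)

text \<open>
  The reciprocal weights are the Taylor coefficients of the reproducing kernel at the boundary point \<open>1\<close>.
\<close>

lemma inverse_wt_sums:
  assumes "norm z < 1"
  shows "(\<lambda>n. complex_of_real (1 / wt n) * z ^ n) sums (1 - z) powr (- of_real (\<alpha> + 2))"
proof -
  have "(- complex_of_real (\<alpha> + 2) gchoose n) * (- z) ^ n = complex_of_real (1 / wt n) * z ^ n" for n
  proof -
    have "(- complex_of_real (\<alpha> + 2) gchoose n) * (- z) ^ n
          = ((-1) ^ n * (-1) ^ n) * (pochhammer (complex_of_real (\<alpha> + 2)) n / fact n * z ^ n)"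
      unfolding gbinomial_pochhammer power_minus[of z] by (simp only: minus_minus mult_ac times_divide_eq_right times_divide_eq_left)
    also have "(-1) ^ n * (-1) ^ n = (1::complex)" by (simp flip: power_mult_distrib)
    finally show ?thesis unfolding inverse_wt pochhammer_of_real by simp
  qed
  then show ?thesis
    using gen_binomial_complex[of "- z" "- of_real (\<alpha> + 2)"] assms by simp
qed

lemma bergman_holomorphic: "h \<in> H \<Longrightarrow> h holomorphic_on ball 0 1"
  and bergman_outside: "h \<in> H \<Longrightarrow> z \<notin> ball 0 1 \<Longrightarrow> h z = 0"
  and bergman_summable: "h \<in> H \<Longrightarrow> summable (\<lambda>n. wt n * (cmod (taylor_coeff h n))\<^sup>2)"
  by (auto simp: bergman_space_def)

lemma on_disk_bergman: "h \<in> H \<Longrightarrow> on_disk h = h"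
  by (auto simp: on_disk_def fun_eq_iff bergman_outside)

lemma bergman_inner_summable:
  assumes "g \<in> H" "h \<in> H"
  shows "summable (\<lambda>n. norm (of_real (wt n) * taylor_coeff g n * cnj (taylor_coeff h n)))"
proof (rule summable_comparison_test')
  show "summable (\<lambda>n. wt n * (cmod (taylor_coeff g n))\<^sup>2 + wt n * (cmod (taylor_coeff h n))\<^sup>2)"
    using assms by (intro summable_add bergman_summable)
  fix n :: nat
  define x y where "x = cmod (taylor_coeff g n)" "y = cmod (taylor_coeff h n)"
  have "x * y \<le> x\<^sup>2 + y\<^sup>2"
  proof -
    have "0 \<le> x * y" by (simp add: x_y_def)
    then show ?thesis using sum_squares_bound[of x y] by linarith
  qed
  then have "wt n * (x * y) \<le> wt n * (x\<^sup>2 + y\<^sup>2)" using wt_pos[of n] by (intro mult_left_mono) auto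
  then show "norm (norm (of_real (wt n) * taylor_coeff g n * cnj (taylor_coeff h n)))
      \<le> wt n * (cmod (taylor_coeff g n))\<^sup>2 + wt n * (cmod (taylor_coeff h n))\<^sup>2"
    using wt_pos[of n] by (simp add: norm_mult x_y_def algebra_simps)
qed

lemma bergman_inner_sums:
  assumes "g \<in> H" "h \<in> H"
  shows "(\<lambda>n. of_real (wt n) * taylor_coeff g n * cnj (taylor_coeff h n)) sums ip g h"
  unfolding bergman_inner_def using summable_norm_cancel[OF bergman_inner_summable[OF assms]]
  by (rule summable_sums)

lemma norm_sq_sums:
  assumes "h \<in> H"
  shows "(\<lambda>n. wt n * (cmod (taylor_coeff h n))\<^sup>2) sums Re (ip h h)"
proof -
  have "Re (of_real (wt n) * taylor_coeff h n * cnj (taylor_coeff h n)) = wt n * (cmod (taylor_coeff h n))\<^sup>2" for n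
    by (simp add: mult.assoc complex_norm_square[symmetric] flip: of_real_power of_real_mult)
  then show ?thesis using sums_Re[OF bergman_inner_sums[OF assms assms]] by simp
qed

lemma coeff_bound:
  assumes "h \<in> H" shows "wt n * (cmod (taylor_coeff h n))\<^sup>2 \<le> Re (ip h h)"
proof -
  have "(\<Sum>i\<in>{n}. wt i * (cmod (taylor_coeff h i))\<^sup>2) \<le> (\<Sum>i. wt i * (cmod (taylor_coeff h i))\<^sup>2)"
    using bergman_summable[OF assms] less_imp_le[OF wt_pos] by (intro sum_le_suminf) auto
  then show ?thesis using sums_unique[OF norm_sq_sums[OF assms]] by simp
qed

lemma bergman_memI:
  assumes "h holomorphic_on ball 0 1" "\<And>z. z \<notin> ball 0 1 \<Longrightarrow> h z = 0"
    and "\<And>k. (\<Sum>n<k. wt n * (cmod (taylor_coeff h n))\<^sup>2) \<le> C"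
  shows "h \<in> H" and "Re (ip h h) \<le> C"
proof -
  have "summable (\<lambda>n. wt n * (cmod (taylor_coeff h n))\<^sup>2)"
  proof (rule bounded_imp_summable)
    show "(\<Sum>n\<le>k. wt n * (cmod (taylor_coeff h n))\<^sup>2) \<le> C" for k
      using assms(3)[of "Suc k"] by (simp only: lessThan_Suc_atMost)
  qed (simp add: less_imp_le[OF wt_pos])
  then show "h \<in> H" using assms by (auto simp: bergman_space_def)
  then show "Re (ip h h) \<le> C"
    using sums_le[OF _ norm_sq_sums] assms(3) norm_sq_sums[OF \<open>h \<in> H\<close>]
    by (simp add: sums_def LIMSEQ_le_const2)
qed

sublocale function_inner_space H ip
proof
  have hol0: "(\<lambda>z. 0::complex) holomorphic_on ball 0 1" by simp
  have "taylor_coeff (\<lambda>z. 0) n = 0" for n using taylor_coeff_scale[OF hol0, of 0 n] by simp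
  then show zero: "(\<lambda>x. 0) \<in> H" by (simp add: bergman_space_def)
  show "(\<lambda>x. g x + h x) \<in> H" if gh: "g \<in> H" "h \<in> H" for g h
  proof (rule bergman_memI(1))
    fix k
    have "(\<Sum>n<k. wt n * (cmod (taylor_coeff (\<lambda>x. g x + h x) n))\<^sup>2)
          \<le> (\<Sum>n<k. 2 * (wt n * (cmod (taylor_coeff g n))\<^sup>2) + 2 * (wt n * (cmod (taylor_coeff h n))\<^sup>2))"
    proof (rule sum_mono)
      fix n
      define x y where "x = taylor_coeff g n" "y = taylor_coeff h n"
      have "(cmod (x + y))\<^sup>2 \<le> (cmod x + cmod y)\<^sup>2" by (intro power_mono norm_triangle_ineq) simp
      also have "\<dots> \<le> 2 * (cmod x)\<^sup>2 + 2 * (cmod y)\<^sup>2"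
        using sum_squares_bound[of "cmod x" "cmod y"] by (simp add: power2_sum)
      finally have "wt n * (cmod (x + y))\<^sup>2 \<le> wt n * (2 * (cmod x)\<^sup>2 + 2 * (cmod y)\<^sup>2)"
        by (intro mult_left_mono less_imp_le[OF wt_pos])
      then show "wt n * (cmod (taylor_coeff (\<lambda>x. g x + h x) n))\<^sup>2
          \<le> 2 * (wt n * (cmod (taylor_coeff g n))\<^sup>2) + 2 * (wt n * (cmod (taylor_coeff h n))\<^sup>2)"
        using gh by (simp add: taylor_coeff_add[where r = 1] bergman_holomorphic x_y_def algebra_simps)
    qed
    also have "\<dots> \<le> (\<Sum>n. 2 * (wt n * (cmod (taylor_coeff g n))\<^sup>2) + 2 * (wt n * (cmod (taylor_coeff h n))\<^sup>2))"
      using gh less_imp_le[OF wt_pos] by (intro sum_le_suminf summable_add summable_mult bergman_summable) auto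
    finally show "(\<Sum>n<k. wt n * (cmod (taylor_coeff (\<lambda>x. g x + h x) n))\<^sup>2) \<le> \<dots>" .
  qed (use gh in \<open>auto intro!: holomorphic_on_add simp: bergman_holomorphic bergman_outside\<close>)
  show "(\<lambda>x. c * h x) \<in> H" if h: "h \<in> H" for c h
  proof -
    have "summable (\<lambda>n. (cmod c)\<^sup>2 * (wt n * (cmod (taylor_coeff h n))\<^sup>2))"
      by (intro summable_mult bergman_summable h)
    then show ?thesis using h bergman_holomorphic[OF h]
      by (auto simp: bergman_space_def taylor_coeff_scale[where r = 1] norm_mult power_mult_distrib mult_ac
          intro!: holomorphic_intros)
  qed
  show "ip (\<lambda>x. g x + h x) k = ip g k + ip h k" if "g \<in> H" "h \<in> H" "k \<in> H" for g h k
    using sums_add[OF bergman_inner_sums[OF that(1,3)] bergman_inner_sums[OF that(2,3)]] that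
    by (simp add: bergman_inner_def taylor_coeff_add[where r = 1] bergman_holomorphic sums_iff algebra_simps)
  show "ip (\<lambda>x. c * h x) k = c * ip h k" if "h \<in> H" "k \<in> H" for c h k
    using sums_mult[OF bergman_inner_sums[OF that], of c] that
    by (simp add: bergman_inner_def taylor_coeff_scale[where r = 1] bergman_holomorphic sums_iff algebra_simps)
  show "cnj (ip g h) = ip h g" if "g \<in> H" "h \<in> H" for g h
  proof -
    have "(\<lambda>n. cnj (of_real (wt n) * taylor_coeff g n * cnj (taylor_coeff h n))) sums cnj (ip g h)"
      using bergman_inner_sums[OF that] by (simp only: sums_cnj)
    then show ?thesis by (simp add: bergman_inner_def sums_iff mult_ac)
  qed
  show "0 \<le> Re (ip h h)" if "h \<in> H" for h
    using coeff_bound[OF that, of 0] wt_pos[of 0]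
    by (meson order.trans mult_nonneg_nonneg less_imp_le zero_le_power2)
  show "h = (\<lambda>x. 0)" if h: "h \<in> H" "Re (ip h h) = 0" for h
  proof (rule eq_if_taylor_coeff_eq)
    fix n
    have "wt n * (cmod (taylor_coeff h n))\<^sup>2 \<le> 0" using coeff_bound[OF h(1), of n] h by simp
    then have "taylor_coeff h n = 0"
      using wt_pos[of n] by (simp add: mult_le_0_iff not_le)
    then show "taylor_coeff h n = taylor_coeff (\<lambda>x. 0) n"
      using \<open>\<And>n. taylor_coeff (\<lambda>z. 0) n = 0\<close> by simp
  qed (use h bergman_holomorphic bergman_outside in auto)
qed

definition monomial :: "nat \<Rightarrow> complex \<Rightarrow> complex" where
  "monomial n = on_disk (\<lambda>z. z ^ n)"

lemma taylor_coeff_monomial: "taylor_coeff (monomial n) m = (if m = n then 1 else 0)"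
  by (simp add: monomial_def taylor_coeff_on_disk taylor_coeff_power)

lemma holomorphic_monomial: "monomial n holomorphic_on ball 0 1"
  unfolding monomial_def holomorphic_on_disk_iff by (intro holomorphic_intros)

lemma monomial_mem: "monomial n \<in> H" and monomial_norm_le: "Re (ip (monomial n) (monomial n)) \<le> 1"
proof -
  have *: "(\<Sum>m<k. wt m * (cmod (taylor_coeff (monomial n) m))\<^sup>2) \<le> 1" for k
  proof -
    have "(\<Sum>m<k. wt m * (cmod (taylor_coeff (monomial n) m))\<^sup>2) = (\<Sum>m<k. if m = n then wt m else 0)"
      by (intro sum.cong) (auto simp: taylor_coeff_monomial)
    also have "\<dots> \<le> 1" using wt_le_one by simp
    finally show ?thesis .
  qed
  show "monomial n \<in> H" by (rule bergman_memI[OF holomorphic_monomial _ *]) (simp add: monomial_def on_disk_def)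
  show "Re (ip (monomial n) (monomial n)) \<le> 1"
    by (rule bergman_memI[OF holomorphic_monomial _ *]) (simp add: monomial_def on_disk_def)
qed

text \<open>
  Polynomials are dense: the squared norms of the remainders of the Taylor series are
  tails of a convergent series.
\<close>

lemma functional_expansion:
  assumes add: "\<And>g h. g \<in> H \<Longrightarrow> h \<in> H \<Longrightarrow> L (\<lambda>z. g z + h z) = L g + L h"
    and scale: "\<And>c h. h \<in> H \<Longrightarrow> L (\<lambda>z. c * h z) = c * L h"
    and bound: "\<And>h. h \<in> H \<Longrightarrow> cmod (L h) \<le> K * hnorm ip h"
    and h: "h \<in> H"
  shows "(\<lambda>n. taylor_coeff h n * L (monomial n)) sums L h"
proof -
  define p where "p N = (\<lambda>z. \<Sum>n<N. taylor_coeff h n * monomial n z)" for N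
  have p_mem: "p N \<in> H \<and> L (p N) = (\<Sum>n<N. taylor_coeff h n * L (monomial n))" for N
  proof (induction N)
    case 0
    have "L (\<lambda>z. 0) = 0" using scale[OF zero_mem, of 0] by simp
    then show ?case by (simp add: p_def zero_mem)
  next
    case (Suc N)
    have "p (Suc N) = (\<lambda>z. p N z + taylor_coeff h N * monomial N z)" by (simp add: p_def)
    then show ?case
      using Suc add[of "p N" "\<lambda>z. taylor_coeff h N * monomial N z"] scale monomial_mem scale_mem
      by (simp add: add_mem)
  qed
  define r where "r N = (\<lambda>z. h z - p N z)" for N
  have r_mem: "r N \<in> H" for N unfolding r_def using p_mem h diff_mem by blast
  have r_coeff: "taylor_coeff (r N) n = (if n < N then 0 else taylor_coeff h n)" for N n
  proof (rule taylor_coeff_eqI[of 1])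
    fix z :: complex assume z: "z \<in> ball 0 1"
    have "(\<lambda>n. taylor_coeff h n * z ^ n - (if n \<in> {..<N} then taylor_coeff h n * z ^ n else 0))
        sums (h z - (\<Sum>n\<in>{..<N}. taylor_coeff h n * z ^ n))"
      by (intro sums_diff sums_If_finite_set taylor_coeff_sums[OF bergman_holomorphic[OF h] z]) simp
    moreover have "(\<Sum>n\<in>{..<N}. taylor_coeff h n * z ^ n) = p N z"
      using z by (simp add: p_def monomial_def on_disk_inside)
    moreover have "taylor_coeff h n * z ^ n - (if n \<in> {..<N} then taylor_coeff h n * z ^ n else 0)
       = (if n < N then 0 else taylor_coeff h n) * z ^ n" for n by simp
    ultimately show "(\<lambda>n. (if n < N then 0 else taylor_coeff h n) * z ^ n) sums r N z"
      by (simp add: r_def)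
  qed simp
  define a where "a n = wt n * (cmod (taylor_coeff h n))\<^sup>2" for n
  have "Re (ip (r N) (r N)) = Re (ip h h) - (\<Sum>n<N. a n)" for N
  proof -
    have "(\<lambda>n. a n - (if n \<in> {..<N} then a n else 0)) sums (Re (ip h h) - (\<Sum>n\<in>{..<N}. a n))"
      unfolding a_def by (intro sums_diff sums_If_finite_set norm_sq_sums[OF h]) simp
    moreover have "a n - (if n \<in> {..<N} then a n else 0) = wt n * (cmod (taylor_coeff (r N) n))\<^sup>2" for n
      by (simp add: r_coeff a_def)
    ultimately show ?thesis using norm_sq_sums[OF r_mem, of N] by (simp add: sums_iff)
  qed
  moreover have "(\<lambda>N. \<Sum>n<N. a n) \<longlonglongrightarrow> Re (ip h h)"
    using norm_sq_sums[OF h] by (simp add: sums_def a_def)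
  then have "(\<lambda>N. Re (ip h h) - (\<Sum>n<N. a n)) \<longlonglongrightarrow> Re (ip h h) - Re (ip h h)"
    by (intro tendsto_diff tendsto_const)
  ultimately have "(\<lambda>N. Re (ip (r N) (r N))) \<longlonglongrightarrow> 0" by simp
  then have "(\<lambda>N. K * hnorm ip (r N)) \<longlonglongrightarrow> K * sqrt 0"
    unfolding hnorm_def by (intro tendsto_mult tendsto_const tendsto_real_sqrt)
  then have lim: "(\<lambda>N. K * hnorm ip (r N)) \<longlonglongrightarrow> 0" by simp
  have "(\<lambda>N. L (r N)) \<longlonglongrightarrow> 0"
    by (rule Lim_null_comparison[OF _ lim]) (simp add: bound r_mem)
  moreover have "L h = L (r N) + L (p N)" for N
    using add[of "r N" "p N"] r_mem p_mem by (simp add: r_def)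
  then have "L (p N) = L h - L (r N)" for N by (metis add_diff_cancel_left')
  ultimately have "(\<lambda>N. L (p N)) \<longlonglongrightarrow> L h - 0"
    by (simp only:) (intro tendsto_diff tendsto_const)
  then show ?thesis using p_mem by (simp add: sums_def)
qed

lemma holomorphic_of_coeffs:
  assumes "\<And>n. cmod (c n) \<le> K / wt n"
  obtains g where "g holomorphic_on ball 0 1" "\<And>n. taylor_coeff g n = c n"
proof -
  have sums: "(\<lambda>n. c n * z ^ n) sums (\<Sum>n. c n * z ^ n)" if z: "z \<in> ball 0 1" for z
  proof (rule summable_sums, rule summable_comparison_test')
    have n: "norm (of_real (norm z) :: complex) < 1" using z by simp
    have "summable (\<lambda>n. Re (complex_of_real (1 / wt n) * of_real (norm z) ^ n))"
      by (rule sums_summable[OF sums_Re[OF inverse_wt_sums[OF n]]])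
    then have "summable (\<lambda>n. (1 / wt n) * norm z ^ n)"
      by (simp only: Re_complex_of_real flip: of_real_power of_real_mult)
    then show "summable (\<lambda>n. K * ((1 / wt n) * norm z ^ n))" by (rule summable_mult)
    fix n
    show "norm (c n * z ^ n) \<le> K * ((1 / wt n) * norm z ^ n)"
      using mult_right_mono[OF assms[of n], of "norm z ^ n"] by (simp add: norm_mult norm_power)
  qed
  show ?thesis
  proof
    show "(\<lambda>z. \<Sum>n. c n * z ^ n) holomorphic_on ball 0 1"
      by (rule power_series_holomorphic) (use sums in simp)
    show "taylor_coeff (\<lambda>z. \<Sum>n. c n * z ^ n) n = c n" for n
      by (rule taylor_coeff_eqI[of 1]) (use sums in auto)
  qed
qed

end

section \<open>Linear fractional maps of the disk fixing the point one\<close>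

lemma powr_mult_right_half_plane:
  fixes u v c :: complex
  assumes "Re u > 0" "Re v > 0"
  shows "(u * v) powr c = u powr c * v powr c"
proof -
  have nz: "u \<noteq> 0" "v \<noteq> 0" using assms by auto
  then have "\<bar>Im (Ln u)\<bar> < pi / 2" "\<bar>Im (Ln v)\<bar> < pi / 2" using assms by (simp_all only: Re_Ln_pos_lt not_False_eq_True)
  then have "Ln (u * v) = Ln u + Ln v" using nz by (intro Ln_times_simple) auto
  then show ?thesis using nz by (simp add: powr_def exp_add ring_distribs)
qed

lemma powr_of_real_right_half_plane:
  assumes "x > 0" shows "complex_of_real x powr of_real c = of_real (x powr c)"
  using assms by (simp add: powr_of_real)

text \<open>
  The linear fractional map whose matrix maps \<open>(1, 1)\<close> to \<open>l (1, 1)\<close> and \<open>(-1, 1)\<close> to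
  \<open>k (1, 1) + d (-1, 1)\<close>. The three parameters are chosen because composition, adjoints and
  square roots are simpler in them than in the matrix entries.
\<close>

definition lft_num :: "real \<Rightarrow> real \<Rightarrow> real \<Rightarrow> complex \<Rightarrow> complex" where
  "lft_num l d k z = of_real ((l + d - k) / 2) * z + of_real ((l - d + k) / 2)"

definition lft_den :: "real \<Rightarrow> real \<Rightarrow> real \<Rightarrow> complex \<Rightarrow> complex" where
  "lft_den l d k z = of_real ((l - d - k) / 2) * z + of_real ((l + d + k) / 2)"

definition lft :: "real \<Rightarrow> real \<Rightarrow> real \<Rightarrow> complex \<Rightarrow> complex" where
  "lft l d k z = lft_num l d k z / lft_den l d k z"

definition admissible :: "real \<Rightarrow> real \<Rightarrow> real \<Rightarrow> bool" where
  "admissible l d k \<longleftrightarrow> l > 0 \<and> d > 0 \<and> k \<ge> 0"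

lemma admissible_swap: "admissible l d k \<Longrightarrow> admissible d l k"
  by (simp add: admissible_def)

lemma den_slope_less:
  assumes "admissible l d k" shows "\<bar>(l - d - k) / 2\<bar> < (l + d + k) / 2"
  using assms by (simp add: admissible_def abs_less_iff field_simps)

lemma lft_den_Re_pos:
  assumes "admissible l d k" "z \<in> ball 0 1"
  shows "Re (lft_den l d k z) > 0"
proof -
  have "\<bar>(l - d - k) / 2 * Re z\<bar> \<le> \<bar>(l - d - k) / 2\<bar> * 1"
    unfolding abs_mult using assms(2) abs_Re_le_cmod[of z] by (intro mult_left_mono) auto
  moreover have "Re (lft_den l d k z) = (l - d - k) / 2 * Re z + (l + d + k) / 2"
    by (simp add: lft_den_def)
  ultimately show ?thesis using den_slope_less[OF assms(1)] by linarith
qed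

lemma lft_den_nonzero: "admissible l d k \<Longrightarrow> z \<in> ball 0 1 \<Longrightarrow> lft_den l d k z \<noteq> 0"
  using lft_den_Re_pos by force

text \<open>
  This identity is the reason why \<open>l, d > 0\<close> and \<open>k \<ge> 0\<close> give self-maps of the disk.
\<close>

lemma lft_disk_identity:
  "(cmod (lft_den l d k z))\<^sup>2 - (cmod (lft_num l d k z))\<^sup>2
     = d * (k * (cmod (1 - z))\<^sup>2 + l * (1 - (cmod z)\<^sup>2))"
  unfolding lft_den_def lft_num_def cmod_power2 by (simp add: field_simps power2_eq_square)

lemma lft_in_disk:
  assumes "admissible l d k" "z \<in> ball 0 1"
  shows "lft l d k z \<in> ball 0 1"
proof -
  have "(cmod z)\<^sup>2 < 1" using assms(2) by (simp add: power_less_one_iff)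
  then have "0 < d * (k * (cmod (1 - z))\<^sup>2 + l * (1 - (cmod z)\<^sup>2))"
    using assms(1) by (intro mult_pos_pos add_nonneg_pos) (auto simp: admissible_def)
  then have "(cmod (lft_num l d k z))\<^sup>2 < (cmod (lft_den l d k z))\<^sup>2"
    by (simp flip: lft_disk_identity)
  then have "cmod (lft_num l d k z) < cmod (lft_den l d k z)"
    by (rule power_less_imp_less_base) simp
  moreover have "cmod (lft_den l d k z) > 0" using lft_den_nonzero[OF assms] by simp
  ultimately show ?thesis by (simp add: lft_def norm_divide)
qed

lemma lft_den_compose:
  assumes "admissible l d k" "z \<in> ball 0 1"
  shows "lft_den l' d' k' (lft l d k z) * lft_den l d k z = lft_den (l' * l) (d' * d) (l' * k + k' * d) z"
proof -
  have "lft_den l' d' k' (lft l d k z) * lft_den l d k z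
      = of_real ((l' - d' - k') / 2) * lft_num l d k z + of_real ((l' + d' + k') / 2) * lft_den l d k z"
    using lft_den_nonzero[OF assms] by (simp add: lft_den_def[of l' d' k'] lft_def field_simps)
  also have "\<dots> = lft_den (l' * l) (d' * d) (l' * k + k' * d) z"
    by (simp add: lft_den_def lft_num_def field_simps)
  finally show ?thesis .
qed

lemma lft_num_compose:
  assumes "admissible l d k" "z \<in> ball 0 1"
  shows "lft_num l' d' k' (lft l d k z) * lft_den l d k z = lft_num (l' * l) (d' * d) (l' * k + k' * d) z"
proof -
  have "lft_num l' d' k' (lft l d k z) * lft_den l d k z
      = of_real ((l' + d' - k') / 2) * lft_num l d k z + of_real ((l' - d' + k') / 2) * lft_den l d k z"
    using lft_den_nonzero[OF assms] by (simp add: lft_num_def[of l' d' k'] lft_def field_simps)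
  also have "\<dots> = lft_num (l' * l) (d' * d) (l' * k + k' * d) z"
    by (simp add: lft_den_def lft_num_def field_simps)
  finally show ?thesis .
qed

lemma lft_compose:
  assumes "admissible l d k" "admissible l' d' k'" "z \<in> ball 0 1"
  shows "lft l' d' k' (lft l d k z) = lft (l' * l) (d' * d) (l' * k + k' * d) z"
  unfolding lft_def[of l' d' k'] lft_def[of "l' * l" "d' * d"]
    lft_den_compose[OF assms(1,3), symmetric] lft_num_compose[OF assms(1,3), symmetric]
  using lft_den_nonzero[OF assms(1,3)] by simp

lemma holomorphic_lft_den [holomorphic_intros]: "lft_den l d k holomorphic_on A"
  unfolding lft_den_def by (intro holomorphic_intros)

lemma holomorphic_lft:
  assumes "admissible l d k" shows "lft l d k holomorphic_on ball 0 1"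
  unfolding lft_def lft_num_def
  by (intro holomorphic_intros) (use lft_den_nonzero[OF assms] in auto)

lemma inj_on_lft:
  assumes "admissible l d k" shows "inj_on (lft l d k) (ball 0 1)"
proof (rule inj_onI)
  fix z w assume zw: "z \<in> ball 0 1" "w \<in> ball 0 1" "lft l d k z = lft l d k w"
  then have "lft_num l d k z * lft_den l d k w - lft_num l d k w * lft_den l d k z = 0"
    using lft_den_nonzero[OF assms] by (simp add: lft_def frac_eq_eq)
  also have "lft_num l d k z * lft_den l d k w - lft_num l d k w * lft_den l d k z
     = of_real (l * d) * (z - w)"
    by (simp add: lft_num_def lft_den_def field_simps)
  finally show "z = w" using assms by (simp add: admissible_def)
qed

text \<open>
  The image of the disk is open, as the map is injective, so the identity theorem applies.
\<close>

lemma zero_if_zero_on_lft_image: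
  assumes "admissible l d k" "h holomorphic_on ball 0 1"
    and zero: "\<And>z. z \<in> ball 0 1 \<Longrightarrow> h (lft l d k z) = 0" and w: "w \<in> ball 0 1"
  shows "h w = 0"
proof -
  define U where "U = lft l d k ` ball 0 1"
  have "open U" unfolding U_def
    by (rule open_mapping_thm3[OF holomorphic_lft[OF assms(1)] _ inj_on_lft[OF assms(1)]]) simp
  have "U \<subseteq> ball 0 1" unfolding U_def using lft_in_disk[OF assms(1)] by (rule image_subsetI)
  have "U \<noteq> {}" by (simp add: U_def)
  have "connected (ball 0 1 :: complex set)" by (rule convex_connected[OF convex_ball])
  have "h u = 0" if "u \<in> U" for u using that zero by (auto simp: U_def)
  then show ?thesis
    using analytic_continuation_open[OF \<open>open U\<close> open_ball \<open>U \<noteq> {}\<close> \<open>connected (ball 0 1)\<close>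
        \<open>U \<subseteq> ball 0 1\<close> assms(2) holomorphic_on_const[of 0] _ w] by simp
qed

section \<open>Weighted composition operators\<close>

context bergman
begin

definition wco :: "real \<Rightarrow> real \<Rightarrow> real \<Rightarrow> (complex \<Rightarrow> complex) \<Rightarrow> complex \<Rightarrow> complex" where
  "wco l d k h = on_disk (\<lambda>z. lft_den l d k z powr (- of_real (\<alpha> + 2)) * h (lft l d k z))"

lemma wco_inside:
  "z \<in> ball 0 1 \<Longrightarrow> wco l d k h z = lft_den l d k z powr (- of_real (\<alpha> + 2)) * h (lft l d k z)"
  by (simp add: wco_def on_disk_def)

lemma wco_outside: "z \<notin> ball 0 1 \<Longrightarrow> wco l d k h z = 0"
  by (simp add: wco_def on_disk_def)

lemma wco_cong:
  assumes "admissible l d k" "\<And>z. z \<in> ball 0 1 \<Longrightarrow> g z = h z"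
  shows "wco l d k g = wco l d k h"
  using assms lft_in_disk[OF assms(1)] by (auto simp: wco_def on_disk_def fun_eq_iff)

text \<open>
  Both weights lie in the right half plane, so the principal powers multiply to the power of the
  product, and the product of the denominators is the denominator of the composed map.
\<close>

lemma wco_wco:
  assumes "admissible l d k" "admissible l' d' k'"
  shows "wco l d k (wco l' d' k' h) = wco (l' * l) (d' * d) (l' * k + k' * d) h"
proof
  fix z
  show "wco l d k (wco l' d' k' h) z = wco (l' * l) (d' * d) (l' * k + k' * d) h z"
  proof (cases "z \<in> ball 0 1")
    case True
    have in_disk: "lft l d k z \<in> ball 0 1" by (rule lft_in_disk[OF assms(1) True])
    show ?thesis
      unfolding wco_inside[OF True] wco_inside[OF in_disk] lft_compose[OF assms True]
        lft_den_compose[OF assms(1) True, symmetric]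
      by (subst powr_mult_right_half_plane)
        (use lft_den_Re_pos[OF assms(1) True] lft_den_Re_pos[OF assms(2) in_disk] in \<open>auto simp: mult_ac\<close>)
  qed (simp add: wco_outside)
qed

lemma wco_scalar:
  assumes "c > 0"
  shows "wco c c 0 h = (\<lambda>z. of_real (c powr (- (\<alpha> + 2))) * on_disk h z)"
proof
  fix z
  have "lft_den c c 0 z = of_real c" "lft_num c c 0 z = of_real c * z"
    by (simp_all add: lft_den_def lft_num_def)
  then show "wco c c 0 h z = of_real (c powr (- (\<alpha> + 2))) * on_disk h z"
    using assms powr_of_real_right_half_plane[OF assms, of "- (\<alpha> + 2)"] by (simp add: wco_def on_disk_def lft_def)
qed

lemma wco_add: "wco l d k (\<lambda>z. g z + h z) = (\<lambda>z. wco l d k g z + wco l d k h z)"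
  by (auto simp: wco_def on_disk_def ring_distribs fun_eq_iff)

lemma wco_scale: "wco l d k (\<lambda>z. c * h z) = (\<lambda>z. c * wco l d k h z)"
  by (auto simp: wco_def on_disk_def fun_eq_iff)

lemma holomorphic_weight:
  assumes "admissible l d k"
  shows "(\<lambda>z. lft_den l d k z powr c) holomorphic_on ball 0 1"
proof (intro holomorphic_intros)
  fix z :: complex assume "z \<in> ball 0 1"
  then show "lft_den l d k z \<notin> \<real>\<^sub>\<le>\<^sub>0"
    using lft_den_Re_pos[OF assms, of z] by (simp add: complex_nonpos_Reals_iff)
qed

lemma holomorphic_wco:
  assumes "admissible l d k" "h holomorphic_on ball 0 1"
  shows "wco l d k h holomorphic_on ball 0 1"
proof -
  have "(\<lambda>z. h (lft l d k z)) holomorphic_on ball 0 1"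
    using holomorphic_on_compose_gen[OF holomorphic_lft[OF assms(1)] assms(2) image_subsetI]
      lft_in_disk[OF assms(1)]
    by (simp add: o_def)
  then show ?thesis
    unfolding wco_def holomorphic_on_disk_iff
    by (intro holomorphic_on_mult holomorphic_weight assms(1))
qed

lemma wco_eq_0D:
  assumes "admissible l d k" "h holomorphic_on ball 0 1" "wco l d k h = (\<lambda>z. 0)" "w \<in> ball 0 1"
  shows "h w = 0"
proof (rule zero_if_zero_on_lft_image[OF assms(1,2) _ assms(4)])
  fix z :: complex assume z: "z \<in> ball 0 1"
  have "wco l d k h z = 0" using assms(3) by simp
  then show "h (lft l d k z) = 0"
    using wco_inside[OF z, of l d k h] lft_den_nonzero[OF assms(1) z] by (simp add: powr_def)
qed

section \<open>The matrix in the monomial basis\<close>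

text \<open>
  The coefficient of \<open>z\<^sup>m y\<^sup>n\<close> in \<open>(s + r z - q y - p y z)\<close> to the power \<open>-(\<alpha> + 2)\<close>, where \<open>p, q, r, s\<close> are
  the matrix entries (\<open>(d - l + k) / 2\<close> is \<open>- r\<close>). This function of \<open>z\<close> is the image of the kernel
  \<open>(1 - y z)\<close> to the power \<open>-(\<alpha> + 2)\<close>. Replacing the matrix by that of the adjoint exchanges
  \<open>q\<close> and \<open>-r\<close>, hence the roles of \<open>z\<close> and \<open>y\<close>.
\<close>

definition gram :: "real \<Rightarrow> real \<Rightarrow> real \<Rightarrow> nat \<Rightarrow> nat \<Rightarrow> real" where
  "gram l d k m n = (\<Sum>i\<le>min m n. pochhammer (\<alpha> + 2) (m + n - i) / (fact i * fact (n - i) * fact (m - i))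
      * ((l + d - k) / 2) ^ i * ((l - d + k) / 2) ^ (n - i) * ((d - l + k) / 2) ^ (m - i)
      * ((l + d + k) / 2) powr (- (\<alpha> + 2) - real (m + n - i)))"

lemma gram_swap: "gram l d k m n = gram d l k n m"
  unfolding gram_def min.commute[of n m] add.commute[of d l] add.commute[of n m]
  by (intro sum.cong refl) (simp only: mult_ac)

lemma taylor_coeff_affine_power:
  "taylor_coeff (\<lambda>z. (of_real p * z + of_real q) ^ n) i
     = (if i \<le> n then of_real (real (n choose i) * p ^ i * q ^ (n - i)) else 0)"
proof (rule taylor_coeff_eqI[of 1])
  fix z :: complex
  have "(of_real p * z + of_real q) ^ n
      = (\<Sum>i\<in>{..n}. of_real (real (n choose i) * p ^ i * q ^ (n - i)) * z ^ i)"
    unfolding binomial_ring by (intro sum.cong) (auto simp: power_mult_distrib)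
  moreover have "(\<lambda>i. if i \<in> {..n} then of_real (real (n choose i) * p ^ i * q ^ (n - i)) * z ^ i else 0)
      sums (\<Sum>i\<in>{..n}. of_real (real (n choose i) * p ^ i * q ^ (n - i)) * z ^ i)"
    by (rule sums_If_finite_set) simp
  ultimately show "(\<lambda>i. (if i \<le> n then of_real (real (n choose i) * p ^ i * q ^ (n - i)) else 0) * z ^ i)
      sums (of_real p * z + of_real q) ^ n"
    by (simp add: if_distrib[of "\<lambda>c. c * _"] cong: if_cong)
qed simp

lemma taylor_coeff_affine_powr:
  assumes "\<bar>r\<bar> < s"
  shows "taylor_coeff (\<lambda>z. (of_real r * z + of_real s) powr (- of_real c)) j
     = of_real (pochhammer c j / fact j * (- r) ^ j * s powr (- c - real j))"
proof (rule taylor_coeff_eqI[of 1])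
  fix z :: complex assume z: "z \<in> ball 0 1"
  have s: "s > 0" using assms by simp
  have "\<bar>r\<bar> * cmod z \<le> \<bar>r\<bar> * 1" using z by (intro mult_left_mono) auto
  then have n: "norm (of_real (r / s) * z) < 1"
    using assms s by (simp add: norm_mult norm_divide field_simps)
  have "Re (1 + of_real (r / s) * z) > 0"
    using n abs_Re_le_cmod[of "of_real (r / s) * z"] unfolding plus_complex.sel one_complex.sel
    by linarith
  then have "(of_real s * (1 + of_real (r / s) * z)) powr (- of_real c)
      = of_real (s powr - c) * (1 + of_real (r / s) * z) powr (- of_real c)"
    using s powr_of_real_right_half_plane[OF s, of "- c"] by (subst powr_mult_right_half_plane) auto
  moreover have "of_real s * (1 + of_real (r / s) * z) = of_real r * z + of_real s"
    using s by (simp add: field_simps)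
  ultimately have eq: "(of_real r * z + of_real s) powr (- of_real c)
      = of_real (s powr - c) * (1 + of_real (r / s) * z) powr (- of_real c)" by simp
  have coeff_eq: "of_real (s powr - c) * ((- of_real c gchoose j) * (of_real (r / s) * z) ^ j)
      = of_real (pochhammer c j / fact j * (- r) ^ j * s powr (- c - real j)) * z ^ j" for j
  proof -
    have 1: "(- complex_of_real c gchoose j) = of_real ((-1) ^ j * pochhammer c j / fact j)"
      unfolding gbinomial_pochhammer by (simp add: pochhammer_of_real)
    have 2: "s powr (- c - real j) = s powr (- c) / s ^ j"
      using s by (simp add: powr_diff powr_realpow)
    have 3: "(- r) ^ j = (- 1) ^ j * r ^ j" by (rule power_minus)
    show ?thesis
      unfolding 1 2 3 power_mult_distrib by (simp add: power_divide)
  qed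
  show "(\<lambda>j. of_real (pochhammer c j / fact j * (- r) ^ j * s powr (- c - real j)) * z ^ j)
      sums (of_real r * z + of_real s) powr (- of_real c)"
    unfolding eq coeff_eq[symmetric] by (intro sums_mult gen_binomial_complex n)
qed simp

text \<open>
  Cauchy product of \<open>(p z + q)\<^sup>n\<close> and the binomial series of \<open>r z + s\<close> to the power \<open>-(\<alpha> + 2) - n\<close>.
\<close>

lemma wco_matrix:
  assumes adm: "admissible l d k"
  shows "taylor_coeff (wco l d k (\<lambda>z. z ^ n)) m = of_real (wt n * gram l d k m n)"
proof -
  define p q r s where "p = (l + d - k) / 2" "q = (l - d + k) / 2" "r = (l - d - k) / 2" "s = (l + d + k) / 2"
  note defs = p_q_r_s_def
  have rs: "\<bar>r\<bar> < s" using den_slope_less[OF adm] by (simp add: defs)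
  then have s: "s > 0" by simp
  define c where "c = \<alpha> + 2 + real n"
  have den: "lft_den l d k = (\<lambda>z. of_real r * z + of_real s)"
    and num: "lft_num l d k = (\<lambda>z. of_real p * z + of_real q)"
    by (simp_all add: lft_den_def lft_num_def defs fun_eq_iff)
  have "taylor_coeff (wco l d k (\<lambda>z. z ^ n)) m
      = taylor_coeff (\<lambda>z. (of_real p * z + of_real q) ^ n * lft_den l d k z powr (- of_real c)) m"
  proof (rule taylor_coeff_cong[of 1])
    fix z :: complex assume z: "z \<in> ball 0 1"
    have nz: "lft_den l d k z \<noteq> 0" by (rule lft_den_nonzero[OF adm z])
    have "- complex_of_real c = - of_real (\<alpha> + 2) - of_nat n" by (simp add: c_def)
    then have "lft_den l d k z powr (- of_real c) = lft_den l d k z powr (- of_real (\<alpha> + 2)) / lft_den l d k z ^ n"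
      using nz by (simp only: powr_diff powr_nat') (simp add: powr_nat)
    then show "wco l d k (\<lambda>z. z ^ n) z = (of_real p * z + of_real q) ^ n * lft_den l d k z powr (- of_real c)"
      by (simp add: wco_inside[OF z] lft_def num power_divide)
  qed simp
  also have "\<dots> = (\<Sum>i\<le>m. taylor_coeff (\<lambda>z. (of_real p * z + of_real q) ^ n) i
                    * taylor_coeff (\<lambda>z. (of_real r * z + of_real s) powr (- of_real c)) (m - i))"
    using holomorphic_weight[OF adm, of "- of_real c"]
    by (subst taylor_coeff_mult[where r = 1]) (auto simp: den intro!: holomorphic_intros)
  also have "\<dots> = (\<Sum>i\<le>m. if i \<le> n then of_real (real (n choose i) * p ^ i * q ^ (n - i)
            * (pochhammer c (m - i) / fact (m - i) * (- r) ^ (m - i) * s powr (- c - real (m - i)))) else 0)"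
    unfolding taylor_coeff_affine_power taylor_coeff_affine_powr[OF rs] by (intro sum.cong) auto
  also have "\<dots> = (\<Sum>i\<le>min m n. of_real (real (n choose i) * p ^ i * q ^ (n - i)
            * (pochhammer c (m - i) / fact (m - i) * (- r) ^ (m - i) * s powr (- c - real (m - i)))))"
    by (intro sum.mono_neutral_cong_right) auto
  also have "\<dots> = (\<Sum>i\<le>min m n. of_real (wt n * (pochhammer (\<alpha> + 2) (m + n - i) / (fact i * fact (n - i) * fact (m - i))
      * p ^ i * q ^ (n - i) * (- r) ^ (m - i) * s powr (- (\<alpha> + 2) - real (m + n - i)))))"
  proof (intro sum.cong refl arg_cong[where f = of_real])
    fix i assume "i \<in> {..min m n}"
    then have i: "i \<le> m" "i \<le> n" by auto
    have e: "m + n - i = n + (m - i)" using i by simp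
    have 1: "pochhammer (\<alpha> + 2) (m + n - i) = pochhammer (\<alpha> + 2) n * pochhammer c (m - i)"
      unfolding e c_def by (rule pochhammer_product')
    have 2: "- (\<alpha> + 2) - real (m + n - i) = - c - real (m - i)" unfolding e c_def by simp
    have 3: "real (n choose i) = fact n / (fact i * fact (n - i))" using i by (simp add: binomial_fact)
    have "pochhammer (\<alpha> + 2) n \<noteq> 0" using pochhammer_pos[of "\<alpha> + 2" n] \<alpha> by simp
    then show "real (n choose i) * p ^ i * q ^ (n - i)
            * (pochhammer c (m - i) / fact (m - i) * (- r) ^ (m - i) * s powr (- c - real (m - i)))
        = wt n * (pochhammer (\<alpha> + 2) (m + n - i) / (fact i * fact (n - i) * fact (m - i))
      * p ^ i * q ^ (n - i) * (- r) ^ (m - i) * s powr (- (\<alpha> + 2) - real (m + n - i)))"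
      unfolding 1 2 3 wt_pochhammer by simp
  qed
  also have "\<dots> = of_real (wt n * gram l d k m n)"
  proof -
    have "(d - l + k) / 2 = - r" by (simp add: defs field_simps)
    then show ?thesis unfolding gram_def sum_distrib_left of_real_sum by (simp only: defs)
  qed
  finally show ?thesis .
qed

lemma taylor_coeff_wco_sum:
  assumes adm: "admissible l d k"
  shows "taylor_coeff (wco l d k (\<lambda>z. \<Sum>n<N. x n * z ^ n)) m
     = (\<Sum>n<N. of_real (wt n * gram l d k m n) * x n)"
proof (induction N)
  case 0
  have "wco l d k (\<lambda>z. 0) = (\<lambda>z. 0)" by (simp add: wco_def on_disk_def fun_eq_iff)
  then show ?case using taylor_coeff_scale[of "\<lambda>z. 0" 1 0 m] by simp
next
  case (Suc N)
  have hol: "(\<lambda>z. \<Sum>n<N. x n * z ^ n) holomorphic_on ball 0 1" "(\<lambda>z. z ^ N) holomorphic_on ball 0 1"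
    by (intro holomorphic_intros)+
  show ?case
    using Suc hol
    by (simp add: wco_add wco_scale taylor_coeff_add[where r = 1] taylor_coeff_scale[where r = 1]
        holomorphic_wco[OF adm] holomorphic_on_mult wco_matrix[OF adm] mult_ac)
qed

text \<open>
  The matrix acts on the Taylor coefficients of any holomorphic function, even outside the
  Bergman space: the map carries a smaller disk into a compact subset of the unit disk, where the
  Taylor polynomials converge uniformly, and uniform limits preserve Taylor coefficients.
\<close>

lemma wco_expansion:
  assumes adm: "admissible l d k" and h: "h holomorphic_on ball 0 1"
  shows "(\<lambda>n. of_real (wt n * gram l d k m n) * taylor_coeff h n) sums taylor_coeff (wco l d k h) m"
proof -
  define A where "A = (ball 0 (1/2) :: complex set)"
  define C where "C = (cball 0 (1/2) :: complex set)"
  have AC: "A \<subseteq> C" "C \<subseteq> ball 0 1" "compact C" "C \<noteq> {}" by (auto simp: A_def C_def)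
  have cont: "continuous_on C (lft l d k)"
    using holomorphic_on_imp_continuous_on[OF holomorphic_lft[OF adm]] AC continuous_on_subset by blast
  then obtain z0 where z0: "z0 \<in> C" "\<And>z. z \<in> C \<Longrightarrow> cmod (lft l d k z) \<le> cmod (lft l d k z0)"
    using continuous_attains_sup[of C "\<lambda>z. cmod (lft l d k z)"] AC by (metis continuous_on_norm)
  define \<rho> where "\<rho> = cmod (lft l d k z0)"
  have \<rho>: "\<rho> < 1" using lft_in_disk[OF adm, of z0] z0 AC by (auto simp: \<rho>_def)
  have "conv_radius (taylor_coeff h) \<ge> 1"
  proof (rule conv_radius_geI_ex)
    fix r' :: real assume r': "0 < r'" "ereal r' < 1"
    then have "complex_of_real r' \<in> ball 0 1" by simp
    then show "\<exists>z. norm z = r' \<and> summable (\<lambda>n. taylor_coeff h n * z ^ n)"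
      using sums_summable[OF taylor_coeff_sums[OF h]] r' by (intro exI[of _ "of_real r'"]) auto
  qed
  then have "ereal \<rho> < conv_radius (taylor_coeff h)"
    using \<rho> by (metis ereal_less(3) less_le_trans)
  from powser_uniform_limit[OF this, of 0]
  have "uniform_limit (cball 0 \<rho>) (\<lambda>N z. \<Sum>n<N. taylor_coeff h n * z ^ n)
          (\<lambda>z. \<Sum>n. taylor_coeff h n * z ^ n) sequentially" by simp
  also have "?this \<longleftrightarrow> uniform_limit (cball 0 \<rho>) (\<lambda>N z. \<Sum>n<N. taylor_coeff h n * z ^ n) h sequentially"
    by (rule uniform_limit_cong') (use sums_unique[OF taylor_coeff_sums[OF h]] \<rho> in \<open>auto simp: eq_commute\<close>)
  finally have "uniform_limit A (\<lambda>N z. \<Sum>n<N. taylor_coeff h n * lft l d k z ^ n) (\<lambda>z. h (lft l d k z)) sequentially"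
    by (rule uniform_limit_compose') (use z0 AC in \<open>auto simp: \<rho>_def\<close>)
  then have "uniform_limit A
      (\<lambda>N z. lft_den l d k z powr (- of_real (\<alpha> + 2)) * (\<Sum>n<N. taylor_coeff h n * lft l d k z ^ n))
      (\<lambda>z. lft_den l d k z powr (- of_real (\<alpha> + 2)) * h (lft l d k z)) sequentially"
  proof (rule uniform_lim_mult[OF uniform_limit_const])
    have "continuous_on C (\<lambda>z. lft_den l d k z powr (- of_real (\<alpha> + 2)))"
      using holomorphic_on_imp_continuous_on[OF holomorphic_weight[OF adm]] AC continuous_on_subset by blast
    then show "bounded ((\<lambda>z. lft_den l d k z powr (- of_real (\<alpha> + 2))) ` A)"
      using AC compact_imp_bounded[OF compact_continuous_image] bounded_subset image_mono by metis
    have "continuous_on (lft l d k ` C) h"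
      using holomorphic_on_imp_continuous_on[OF h] lft_in_disk[OF adm] AC
      by (auto intro!: continuous_on_subset[of "ball 0 1" h])
    then have "continuous_on C (\<lambda>z. h (lft l d k z))" using continuous_on_compose2[OF _ cont] by blast
    then show "bounded ((\<lambda>z. h (lft l d k z)) ` A)"
      using AC compact_imp_bounded[OF compact_continuous_image] bounded_subset image_mono by metis
  qed
  also have "?this \<longleftrightarrow> uniform_limit A (\<lambda>N. wco l d k (\<lambda>z. \<Sum>n<N. taylor_coeff h n * z ^ n)) (wco l d k h) sequentially"
    by (rule uniform_limit_cong') (use AC in \<open>auto simp: wco_inside subset_iff\<close>)
  finally have "(\<lambda>N. (deriv ^^ m) (wco l d k (\<lambda>z. \<Sum>n<N. taylor_coeff h n * z ^ n)) 0)
                  \<longlonglongrightarrow> (deriv ^^ m) (wco l d k h) 0"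
  proof (rule higher_deriv_complex_uniform_limit)
    have "wco l d k (\<lambda>z. \<Sum>n<N. taylor_coeff h n * z ^ n) holomorphic_on A" for N
      by (rule holomorphic_on_subset[OF holomorphic_wco[OF adm]]) (use AC in \<open>auto intro!: holomorphic_intros\<close>)
    then show "\<forall>\<^sub>F N in sequentially. wco l d k (\<lambda>z. \<Sum>n<N. taylor_coeff h n * z ^ n) holomorphic_on A"
      by simp
  qed (auto simp: A_def)
  then have "(\<lambda>N. taylor_coeff (wco l d k (\<lambda>z. \<Sum>n<N. taylor_coeff h n * z ^ n)) m)
                \<longlonglongrightarrow> taylor_coeff (wco l d k h) m"
    unfolding taylor_coeff_def[of "wco _ _ _ _"] by (intro tendsto_divide tendsto_const) auto
  then show ?thesis unfolding taylor_coeff_wco_sum[OF adm] sums_def .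
qed

section \<open>Boundedness\<close>

text \<open>
  Boundedness with a bound \<open>C\<close> on the square of the operator norm.
\<close>

definition wco_bounded :: "real \<Rightarrow> real \<Rightarrow> real \<Rightarrow> real \<Rightarrow> bool" where
  "wco_bounded l d k C \<longleftrightarrow> C \<ge> 0 \<and>
     (\<forall>h\<in>H. wco l d k h \<in> H \<and> Re (ip (wco l d k h) (wco l d k h)) \<le> C * Re (ip h h))"

text \<open>
  Finite sections of the matrix suffice: let the number of columns, then the number of rows, tend to infinity.
\<close>

lemma wco_boundedI:
  assumes adm: "admissible l d k" and C: "C \<ge> 0"
    and sections: "\<And>M N x. (\<Sum>m<M. wt m * (cmod (\<Sum>n<N. of_real (wt n * gram l d k m n) * x n))\<^sup>2)
        \<le> C * (\<Sum>n<N. wt n * (cmod (x n))\<^sup>2)"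
  shows "wco_bounded l d k C"
  unfolding wco_bounded_def
proof (intro conjI ballI C)
  fix h assume h: "h \<in> H"
  have bound: "(\<Sum>m<M. wt m * (cmod (taylor_coeff (wco l d k h) m))\<^sup>2) \<le> C * Re (ip h h)" for M
  proof (rule LIMSEQ_le_const2)
    have "(\<lambda>N. \<Sum>n<N. of_real (wt n * gram l d k m n) * taylor_coeff h n) \<longlonglongrightarrow> taylor_coeff (wco l d k h) m" for m
      using wco_expansion[OF adm bergman_holomorphic[OF h]] by (simp add: sums_def)
    then show "(\<lambda>N. \<Sum>m<M. wt m * (cmod (\<Sum>n<N. of_real (wt n * gram l d k m n) * taylor_coeff h n))\<^sup>2)
        \<longlonglongrightarrow> (\<Sum>m<M. wt m * (cmod (taylor_coeff (wco l d k h) m))\<^sup>2)"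
      by (intro tendsto_sum tendsto_mult tendsto_const tendsto_power tendsto_norm)
    have "(\<Sum>m<M. wt m * (cmod (\<Sum>n<N. of_real (wt n * gram l d k m n) * taylor_coeff h n))\<^sup>2)
       \<le> C * Re (ip h h)" for N
    proof -
      have "(\<Sum>n<N. wt n * (cmod (taylor_coeff h n))\<^sup>2) \<le> (\<Sum>n. wt n * (cmod (taylor_coeff h n))\<^sup>2)"
        using bergman_summable[OF h] less_imp_le[OF wt_pos] by (intro sum_le_suminf) auto
      then have "C * (\<Sum>n<N. wt n * (cmod (taylor_coeff h n))\<^sup>2) \<le> C * Re (ip h h)"
        using sums_unique[OF norm_sq_sums[OF h]] C by (intro mult_left_mono) auto
      then show ?thesis using sections order.trans by blast
    qed
    then show "\<exists>N0. \<forall>N\<ge>N0. (\<Sum>m<M. wt m * (cmod (\<Sum>n<N. of_real (wt n * gram l d k m n) * taylor_coeff h n))\<^sup>2)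
       \<le> C * Re (ip h h)" by blast
  qed
  show "wco l d k h \<in> H"
    by (rule bergman_memI(1)[OF holomorphic_wco[OF adm bergman_holomorphic[OF h]] wco_outside bound])
  show "Re (ip (wco l d k h) (wco l d k h)) \<le> C * Re (ip h h)"
    by (rule bergman_memI(2)[OF holomorphic_wco[OF adm bergman_holomorphic[OF h]] wco_outside bound])
qed

lemma wco_bounded_compose:
  assumes "admissible l d k" "admissible l' d' k'" "wco_bounded l d k C" "wco_bounded l' d' k' C'"
  shows "wco_bounded (l' * l) (d' * d) (l' * k + k' * d) (C * C')"
  unfolding wco_bounded_def wco_wco[OF assms(1,2), symmetric]
proof (intro conjI ballI)
  show "0 \<le> C * C'" using assms(3,4) by (simp add: wco_bounded_def)
  fix h assume h: "h \<in> H"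
  have 1: "wco l' d' k' h \<in> H" "Re (ip (wco l' d' k' h) (wco l' d' k' h)) \<le> C' * Re (ip h h)"
    using assms(4) h by (auto simp: wco_bounded_def)
  then show "wco l d k (wco l' d' k' h) \<in> H" using assms(3) by (auto simp: wco_bounded_def)
  have "Re (ip (wco l d k (wco l' d' k' h)) (wco l d k (wco l' d' k' h)))
        \<le> C * Re (ip (wco l' d' k' h) (wco l' d' k' h))"
    using assms(3) 1 by (auto simp: wco_bounded_def)
  also have "\<dots> \<le> C * (C' * Re (ip h h))"
    using 1 assms(3) by (intro mult_left_mono) (auto simp: wco_bounded_def)
  finally show "Re (ip (wco l d k (wco l' d' k' h)) (wco l d k (wco l' d' k' h))) \<le> C * C' * Re (ip h h)"
    by (simp add: mult_ac)
qed

text \<open>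
  For \<open>k = 0\<close> the images of the monomials are orthogonal. By symmetry of the matrix the sum
  of products of two columns is a Taylor coefficient of the operator of \<open>(d, l, 0)\<close> applied to the image
  of a monomial, and \<open>(d, l, 0) (l, d, 0) = (l d, l d, 0)\<close> is a scalar.
\<close>

lemma gram_diagonal_orthogonal:
  assumes "l > 0" "d > 0"
  shows "(\<lambda>m. wt m * (wt n * gram l d 0 m n) * (wt j * gram l d 0 m j))
     sums (if n = j then (l * d) powr (- (\<alpha> + 2)) * wt n else 0)"
proof -
  have adm: "admissible l d 0" "admissible d l 0" using assms by (auto simp: admissible_def)
  define c where "c = (l * d) powr (- (\<alpha> + 2))"
  have hol: "(\<lambda>z. z ^ j) holomorphic_on ball 0 1" by (intro holomorphic_intros)
  have "wco d l 0 (wco l d 0 (\<lambda>z. z ^ j)) = (\<lambda>z. of_real c * on_disk (\<lambda>z. z ^ j) z)"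
    using wco_wco[OF adm(2,1), of "\<lambda>z. z ^ j"] wco_scalar[of "l * d" "\<lambda>z. z ^ j"] assms
    by (simp add: mult.commute c_def)
  then have "taylor_coeff (wco d l 0 (wco l d 0 (\<lambda>z. z ^ j))) n = of_real c * (if n = j then 1 else 0)"
    using hol by (simp add: taylor_coeff_scale[where r = 1] holomorphic_on_disk_iff
        taylor_coeff_on_disk taylor_coeff_power)
  with wco_expansion[OF adm(2) holomorphic_wco[OF adm(1) hol], of n]
  have "(\<lambda>m. of_real (wt m * gram d l 0 n m) * of_real (wt j * gram l d 0 m j))
          sums (of_real (c * (if n = j then 1 else 0)) :: complex)"
    by (cases "n = j") (simp_all add: wco_matrix[OF adm(1)])
  then have "(\<lambda>m. wt m * gram d l 0 n m * (wt j * gram l d 0 m j)) sums (c * (if n = j then 1 else 0))"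
    by (simp only: sums_of_real_iff flip: of_real_mult)
  then have "(\<lambda>m. wt n * (wt m * gram l d 0 m n * (wt j * gram l d 0 m j))) sums (wt n * (c * (if n = j then 1 else 0)))"
    unfolding gram_swap[of d l] by (rule sums_mult)
  then show ?thesis unfolding c_def[symmetric] by (simp add: mult_ac if_distrib cong: if_cong)
qed

lemma wco_bounded_diagonal:
  assumes "l > 0" "d > 0"
  shows "wco_bounded l d 0 ((l * d) powr (- (\<alpha> + 2)))"
proof (rule wco_boundedI)
  define c where "c = (l * d) powr (- (\<alpha> + 2))"
  define A where "A m n = wt n * gram l d 0 m n" for m n
  fix M N :: nat and x :: "nat \<Rightarrow> complex"
  define S where "S m = wt m * (cmod (\<Sum>n<N. of_real (A m n) * x n))\<^sup>2" for m
  have S_eq: "S m = Re (\<Sum>n<N. \<Sum>j<N. of_real (wt m * A m n * A m j) * (x n * cnj (x j)))" for m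
  proof -
    have "complex_of_real ((cmod (\<Sum>n<N. of_real (A m n) * x n))\<^sup>2)
        = (\<Sum>n<N. of_real (A m n) * x n) * (\<Sum>j<N. of_real (A m j) * cnj (x j))"
      by (simp add: complex_norm_square del: of_real_power)
    also have "of_real (wt m) * \<dots> = (\<Sum>n<N. \<Sum>j<N. of_real (wt m * A m n * A m j) * (x n * cnj (x j)))"
      unfolding sum_product unfolding sum_distrib_left by (intro sum.cong refl) (simp add: mult_ac)
    finally show ?thesis unfolding S_def by (metis Re_complex_of_real of_real_mult)
  qed
  have "(\<lambda>m. \<Sum>n<N. \<Sum>j<N. of_real (wt m * A m n * A m j) * (x n * cnj (x j)))
      sums (\<Sum>n<N. \<Sum>j<N. of_real (if n = j then c * wt n else 0) * (x n * cnj (x j)))"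
    unfolding A_def c_def
    by (intro sums_sum sums_mult2 sums_of_real gram_diagonal_orthogonal assms)
  then have "S sums Re (\<Sum>n<N. \<Sum>j<N. of_real (if n = j then c * wt n else 0) * (x n * cnj (x j)))"
    unfolding S_eq[abs_def] by (rule sums_Re)
  also have "(\<Sum>n<N. \<Sum>j<N. of_real (if n = j then c * wt n else 0) * (x n * cnj (x j)))
      = (\<Sum>n<N. of_real (c * wt n * (cmod (x n))\<^sup>2))"
  proof (intro sum.cong refl)
    fix n assume "n \<in> {..<N}"
    then show "(\<Sum>j<N. of_real (if n = j then c * wt n else 0) * (x n * cnj (x j)))
        = of_real (c * wt n * (cmod (x n))\<^sup>2)"
      by (simp add: if_distrib[of of_real] if_distrib[of "\<lambda>u. u * _"] complex_norm_square
          del: of_real_power cong: if_cong)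
  qed
  finally have S_sums: "S sums (c * (\<Sum>n<N. wt n * (cmod (x n))\<^sup>2))"
    by (simp add: sum_distrib_left mult_ac flip: of_real_mult of_real_power of_real_sum)
  have "sum S {..<M} \<le> suminf S"
    using sums_summable[OF S_sums] less_imp_le[OF wt_pos] by (intro sum_le_suminf) (auto simp: S_def)
  then show "(\<Sum>m<M. wt m * (cmod (\<Sum>n<N. of_real (wt n * gram l d 0 m n) * x n))\<^sup>2)
        \<le> (l * d) powr (- (\<alpha> + 2)) * (\<Sum>n<N. wt n * (cmod (x n))\<^sup>2)"
    using sums_unique[OF S_sums] by (simp add: S_def[abs_def] A_def c_def)
qed (use assms in \<open>auto simp: admissible_def\<close>)

text \<open>
  As the map fixes \<open>1\<close>, the kernel \<open>(1 - z)\<close> to the power \<open>-(\<alpha> + 2)\<close> at the boundary point \<open>1\<close> is an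
  eigenfunction. It does not belong to the Bergman space, but the matrix acts on its Taylor coefficients,
  which are the reciprocal weights.
\<close>

lemma gram_row_sums:
  assumes adm: "admissible l d k"
  shows "(\<lambda>n. gram l d k m n) sums (d powr (- (\<alpha> + 2)) / wt m)"
proof -
  define b where "b = complex_of_real (\<alpha> + 2)"
  define g where "g z = (1 - z) powr (- b)" for z :: complex
  have hol: "g holomorphic_on ball 0 1"
    unfolding g_def
  proof (intro holomorphic_intros)
    fix z :: complex assume "z \<in> ball 0 1"
    then have "Re (1 - z) > 0" using complex_Re_le_cmod[of z] by simp
    then show "1 - z \<notin> \<real>\<^sub>\<le>\<^sub>0" by (simp add: complex_nonpos_Reals_iff)
  qed
  have coeff: "taylor_coeff g n = of_real (1 / wt n)" for n
    by (rule taylor_coeff_eqI[of 1]) (use inverse_wt_sums in \<open>auto simp: g_def b_def\<close>)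
  have d: "d > 0" using adm by (simp add: admissible_def)
  have "taylor_coeff (wco l d k g) m = taylor_coeff (\<lambda>z. of_real (d powr (- (\<alpha> + 2))) * g z) m"
  proof (rule taylor_coeff_cong[of 1])
    fix z :: complex assume z: "z \<in> ball 0 1"
    have w: "Re (1 - lft l d k z) > 0" and z': "Re (1 - z) > 0"
      using lft_in_disk[OF adm z] z abs_Re_le_cmod[of "lft l d k z"] abs_Re_le_cmod[of z] by auto
    have "lft_den l d k z * (1 - lft l d k z) = of_real d * (1 - z)"
    proof -
      have "lft_den l d k z * (1 - lft l d k z) = lft_den l d k z - lft_num l d k z"
        using lft_den_nonzero[OF adm z] by (simp add: lft_def right_diff_distrib)
      also have "\<dots> = of_real d * (1 - z)" by (simp add: lft_den_def lft_num_def field_simps)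
      finally show ?thesis .
    qed
    then have "lft_den l d k z powr (- b) * (1 - lft l d k z) powr (- b) = of_real d powr (- b) * (1 - z) powr (- b)"
      using d z' by (simp flip: powr_mult_right_half_plane[OF lft_den_Re_pos[OF adm z] w] add: powr_mult_right_half_plane)
    then show "wco l d k g z = of_real (d powr (- (\<alpha> + 2))) * g z"
      using powr_of_real_right_half_plane[OF d, of "- (\<alpha> + 2)"] by (simp add: wco_inside[OF z] g_def b_def)
  qed simp
  also have "\<dots> = of_real (d powr (- (\<alpha> + 2)) / wt m)"
    using hol by (simp add: taylor_coeff_scale[where r = 1] coeff)
  finally have "(\<lambda>n. complex_of_real (gram l d k m n)) sums of_real (d powr (- (\<alpha> + 2)) / wt m)"
    using wco_expansion[OF adm hol, of m] less_imp_neq[OF wt_pos, symmetric] by (simp add: coeff)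
  then show ?thesis by (simp only: sums_of_real_iff)
qed

text \<open>
  The Schur test. The row sums give one of the two required estimates, and the column sums,
  which are row sums for the adjoint triple, the other.
\<close>

lemma wco_bounded_nonneg_matrix:
  assumes adm: "admissible l d k" and nonneg: "\<And>m n. gram l d k m n \<ge> 0"
  shows "wco_bounded l d k ((l * d) powr (- (\<alpha> + 2)))"
proof (rule wco_boundedI[OF adm])
  fix M N :: nat and x :: "nat \<Rightarrow> complex"
  define G where "G = gram l d k"
  define a b where "a = l powr (- (\<alpha> + 2))" "b = d powr (- (\<alpha> + 2))"
  have row: "(\<Sum>n<N. G m n) \<le> b / wt m" for m
    using sum_le_suminf[OF sums_summable[OF gram_row_sums[OF adm]], of "{..<N}" m] nonneg
      sums_unique[OF gram_row_sums[OF adm, of m]] by (simp add: G_def a_b_def)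
  have col: "(\<Sum>m<M. G m n) \<le> a / wt n" for n
    using sum_le_suminf[OF sums_summable[OF gram_row_sums[OF admissible_swap[OF adm]]], of "{..<M}" n] nonneg
      sums_unique[OF gram_row_sums[OF admissible_swap[OF adm], of n]]
    by (simp add: G_def a_b_def gram_swap[of d l])
  have G0: "G m n \<ge> 0" for m n using nonneg by (simp add: G_def)
  have "wt m * (cmod (\<Sum>n<N. of_real (wt n * G m n) * x n))\<^sup>2
      \<le> b * (\<Sum>n<N. G m n * (wt n * cmod (x n))\<^sup>2)" for m
  proof -
    have "cmod (\<Sum>n<N. of_real (wt n * G m n) * x n) \<le> (\<Sum>n<N. sqrt (G m n) * (sqrt (G m n) * (wt n * cmod (x n))))"
    proof (rule sum_norm_le)
      fix n
      have "sqrt (G m n) * (sqrt (G m n) * (wt n * cmod (x n))) = G m n * (wt n * cmod (x n))"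
        using G0 by (simp flip: mult.assoc)
      moreover have "cmod (of_real (wt n * G m n) * x n) = G m n * (wt n * cmod (x n))"
        using G0[of m n] wt_pos[of n] by (simp add: norm_mult abs_mult)
      ultimately show "cmod (of_real (wt n * G m n) * x n) \<le> sqrt (G m n) * (sqrt (G m n) * (wt n * cmod (x n)))"
        by (simp only: order_refl)
    qed
    then have "(cmod (\<Sum>n<N. of_real (wt n * G m n) * x n))\<^sup>2
        \<le> (\<Sum>n<N. sqrt (G m n) * (sqrt (G m n) * (wt n * cmod (x n))))\<^sup>2" by (intro power_mono) auto
    also have "\<dots> \<le> (\<Sum>n<N. (sqrt (G m n))\<^sup>2) * (\<Sum>n<N. (sqrt (G m n) * (wt n * cmod (x n)))\<^sup>2)"
      by (rule Cauchy_Schwarz_ineq_sum)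
    also have "\<dots> = (\<Sum>n<N. G m n) * (\<Sum>n<N. G m n * (wt n * cmod (x n))\<^sup>2)"
      using G0 by (simp add: power_mult_distrib)
    also have "\<dots> \<le> b / wt m * (\<Sum>n<N. G m n * (wt n * cmod (x n))\<^sup>2)"
      using G0 by (intro mult_right_mono row sum_nonneg) auto
    finally show ?thesis using wt_pos[of m] by (simp add: field_simps)
  qed
  then have "(\<Sum>m<M. wt m * (cmod (\<Sum>n<N. of_real (wt n * G m n) * x n))\<^sup>2)
      \<le> (\<Sum>m<M. b * (\<Sum>n<N. G m n * (wt n * cmod (x n))\<^sup>2))"
    by (rule sum_mono)
  also have "\<dots> = b * (\<Sum>n<N. (\<Sum>m<M. G m n) * (wt n * cmod (x n))\<^sup>2)"
    unfolding sum_distrib_left[symmetric] by (subst sum.swap) (simp add: sum_distrib_right)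
  also have "\<dots> \<le> b * (\<Sum>n<N. a / wt n * (wt n * cmod (x n))\<^sup>2)"
    by (intro mult_left_mono sum_mono mult_right_mono col) (auto simp: a_b_def)
  also have "\<dots> = (a * b) * (\<Sum>n<N. wt n * (cmod (x n))\<^sup>2)"
    unfolding sum_distrib_left using less_imp_neq[OF wt_pos, symmetric]
    by (intro sum.cong refl) (simp add: power2_eq_square field_simps)
  also have "a * b = (l * d) powr (- (\<alpha> + 2))"
    using adm by (simp add: a_b_def powr_mult admissible_def)
  finally show "(\<Sum>m<M. wt m * (cmod (\<Sum>n<N. of_real (wt n * gram l d k m n) * x n))\<^sup>2)
      \<le> (l * d) powr (- (\<alpha> + 2)) * (\<Sum>n<N. wt n * (cmod (x n))\<^sup>2)" by (simp add: G_def)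
qed simp

text \<open>
  For \<open>k > 0\<close> the triple factors as \<open>(k, d, 0) (2, 1, 1) (l / (2 k), 1, 0)\<close>. The middle triple
  belongs to \<open>z \<Rightarrow> (z + 1) / 2\<close>, whose matrix is nonnegative.
\<close>

lemma wco_bounded_exists:
  assumes "admissible l d k"
  obtains C where "wco_bounded l d k C"
proof (cases "k = 0")
  case True
  then show ?thesis using wco_bounded_diagonal assms that by (auto simp: admissible_def)
next
  case False
  then have pos: "k > 0" "l > 0" "d > 0" using assms by (auto simp: admissible_def)
  have "gram 2 1 1 m n \<ge> 0" for m n
    unfolding gram_def using \<alpha> by (intro sum_nonneg mult_nonneg_nonneg divide_nonneg_nonneg pochhammer_nonneg) auto
  then have B: "wco_bounded 2 1 1 ((2 * 1) powr (- (\<alpha> + 2)))"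
    by (intro wco_bounded_nonneg_matrix) (auto simp: admissible_def)
  have adm: "admissible 2 1 1" "admissible (l / (2 * k)) 1 0" "admissible k d 0" "admissible (l / k) 1 1"
    using pos by (auto simp: admissible_def)
  note first = wco_bounded_compose[OF adm(2,1) wco_bounded_diagonal B]
  have "wco_bounded (l / k) 1 1 ((l / (2 * k) * 1) powr (- (\<alpha> + 2)) * (2 * 1) powr (- (\<alpha> + 2)))"
    using first pos by (simp add: mult_ac)
  from wco_bounded_compose[OF adm(4,3) this wco_bounded_diagonal]
  show ?thesis using that pos by (simp add: mult_ac)
qed

lemma wco_mem: "admissible l d k \<Longrightarrow> h \<in> H \<Longrightarrow> wco l d k h \<in> H"
  by (meson wco_bounded_exists wco_bounded_def)

definition wco_op :: "real \<Rightarrow> real \<Rightarrow> real \<Rightarrow> complex operator" where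
  "wco_op l d k = restrict (wco l d k) H"

lemma wco_op_apply: "h \<in> H \<Longrightarrow> wco_op l d k h = wco l d k h"
  by (simp add: wco_op_def)

lemma bounded_operator_wco:
  assumes "admissible l d k" shows "bounded_operator H ip (wco_op l d k)"
proof -
  obtain C where C: "wco_bounded l d k C" by (rule wco_bounded_exists[OF assms])
  have "hnorm ip (wco_op l d k h) \<le> sqrt C * hnorm ip h" if "h \<in> H" for h
    using C that by (simp add: hnorm_def wco_op_apply wco_bounded_def flip: real_sqrt_mult)
  then show ?thesis
    unfolding bounded_operator_def
    using wco_mem[OF assms] by (auto simp: wco_op_def wco_add wco_scale add_mem scale_mem)
qed

lemma wco_op_compose:
  assumes "admissible l d k" "admissible l' d' k'"
  shows "compose H (wco_op l d k) (wco_op l' d' k') = wco_op (l' * l) (d' * d) (l' * k + k' * d)"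
  using wco_mem[OF assms(2)] wco_wco[OF assms]
  by (auto simp: compose_def wco_op_def restrict_def fun_eq_iff)

section \<open>Adjoints, positivity and dense range\<close>

text \<open>
  By density of polynomials it suffices to take a monomial for \<open>g\<close>; then both sides are the
  same series, by symmetry of the matrix.
\<close>

lemma wco_adjoint:
  assumes adm: "admissible l d k" and g: "g \<in> H" and h: "h \<in> H"
  shows "ip (wco l d k g) h = ip g (wco d l k h)"
proof -
  obtain C where C: "wco_bounded l d k C" by (rule wco_bounded_exists[OF adm])
  note adm' = admissible_swap[OF adm]
  define L where "L u = ip (wco l d k u) h" for u
  have mono: "L (monomial n) = of_real (wt n) * cnj (taylor_coeff (wco d l k h) n)" for n
  proof -
    have "wco l d k (monomial n) = wco l d k (\<lambda>z. z ^ n)"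
      by (rule wco_cong[OF adm]) (simp add: monomial_def on_disk_def)
    then have "(\<lambda>m. of_real (wt m) * of_real (wt n * gram l d k m n) * cnj (taylor_coeff h m)) sums L (monomial n)"
      using bergman_inner_sums[OF wco_mem[OF adm monomial_mem] h, of n] by (simp add: wco_matrix[OF adm] L_def)
    moreover have "(\<lambda>m. of_real (wt n) * cnj (of_real (wt m * gram d l k n m) * taylor_coeff h m))
        sums (of_real (wt n) * cnj (taylor_coeff (wco d l k h) n))"
      by (rule sums_mult) (simp only: sums_cnj wco_expansion[OF adm' bergman_holomorphic[OF h]])
    ultimately show ?thesis
      by (simp add: gram_swap[of d l] mult_ac sums_unique2)
  qed
  have "(\<lambda>n. taylor_coeff g n * L (monomial n)) sums L g"
  proof (rule functional_expansion[OF _ _ _ g])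
    fix u assume u: "u \<in> H"
    show "L (\<lambda>z. c * u z) = c * L u" for c
      using u h by (simp add: L_def wco_scale ip_scale_left wco_mem[OF adm])
    have m: "wco l d k u \<in> H" by (rule wco_mem[OF adm u])
    show "cmod (L u) \<le> (sqrt C * hnorm ip h) * hnorm ip u"
    proof -
      have "cmod (L u) \<le> hnorm ip (wco l d k u) * hnorm ip h"
        unfolding L_def by (rule norm_ip_le[OF m h])
      also have "\<dots> \<le> (sqrt C * hnorm ip u) * hnorm ip h"
        using C u hnorm_nonneg[OF h]
        by (intro mult_right_mono) (auto simp: hnorm_def wco_bounded_def simp flip: real_sqrt_mult)
      finally show ?thesis by (simp add: mult_ac)
    qed
  qed (use h wco_mem[OF adm] in \<open>simp_all add: L_def wco_add ip_add_left\<close>)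
  then have "(\<lambda>n. of_real (wt n) * taylor_coeff g n * cnj (taylor_coeff (wco d l k h) n)) sums L g"
    by (simp add: mono mult_ac)
  then show ?thesis
    using bergman_inner_sums[OF g wco_mem[OF adm' h]] by (simp add: L_def sums_unique2)
qed

lemma adjoint_wco:
  assumes "admissible l d k" shows "adjoint_op H ip (wco_op l d k) = wco_op d l k"
  using bounded_operator_wco[OF admissible_swap[OF assms]]
  by (rule adjoint_op_eqI) (simp add: wco_op_apply wco_adjoint[OF assms])

text \<open>
  A triple with \<open>l = d\<close> is the square of a triple of the same kind, and such triples are self-adjoint.
\<close>

lemma positive_wco:
  assumes "admissible l l k" shows "positive_operator H ip (wco_op l l k)"
proof -
  define c where "c = sqrt l"
  have c: "c > 0" "c * c = l" using assms by (auto simp: c_def admissible_def)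
  define j where "j = k / (2 * c)"
  have adm: "admissible c c j" using c assms by (auto simp: admissible_def j_def)
  have "c * j + j * c = k" using c by (simp add: j_def field_simps)
  then have sq: "wco l l k h = wco c c j (wco c c j h)" for h
    using wco_wco[OF adm adm, of h] c by simp
  have "ip (wco l l k h) h = of_real (Re (ip (wco c c j h) (wco c c j h)))" if h: "h \<in> H" for h
    unfolding sq using wco_adjoint[OF adm wco_mem[OF adm h] h] ip_self[OF wco_mem[OF adm h]] by simp
  then show ?thesis
    unfolding positive_operator_def
    using bounded_operator_wco[OF assms] ip_nonneg wco_mem[OF adm]
    by (simp add: wco_op_apply complex_nonneg_Reals_iff)
qed

lemma sqrt_wco:
  assumes "admissible c c j"
  shows "sqrt_op H ip (wco_op (c * c) (c * c) (2 * c * j)) = wco_op c c j"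
  using positive_wco[OF assms] wco_op_compose[OF assms assms]
  by (intro sqrt_op_eqI) (simp_all add: mult_ac)

text \<open>
  The range of a weighted composition operator is dense. Let \<open>g\<close> be the power series that
  would represent \<open>L\<close>, with coefficients \<open>L (z\<^sup>n)\<close> over the \<open>n\<close>th weight. It converges on the disk, and
  by symmetry of the matrix, \<open>L\<close> vanishing at the images of the monomials says that the adjoint
  triple annihilates \<open>g\<close>. So \<open>g = 0\<close>, and \<open>L\<close> vanishes on polynomials.
\<close>

lemma functional_zero_if_zero_on_range:
  assumes adm: "admissible l d k"
    and add: "\<And>g h. g \<in> H \<Longrightarrow> h \<in> H \<Longrightarrow> L (\<lambda>z. g z + h z) = L g + L h"
    and scale: "\<And>c h. h \<in> H \<Longrightarrow> L (\<lambda>z. c * h z) = c * L h"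
    and bound: "\<And>h. h \<in> H \<Longrightarrow> cmod (L h) \<le> K * hnorm ip h"
    and zero: "\<And>h. h \<in> H \<Longrightarrow> L (wco l d k h) = 0" and h: "h \<in> H"
  shows "L h = 0"
proof -
  note adm' = admissible_swap[OF adm]
  have K: "cmod (L (monomial n)) \<le> \<bar>K\<bar>" for n
  proof -
    have "hnorm ip (monomial n) \<le> 1" using monomial_norm_le by (simp add: hnorm_def)
    then have "\<bar>K\<bar> * hnorm ip (monomial n) \<le> \<bar>K\<bar>" by (simp add: mult_left_le)
    moreover have "K * hnorm ip (monomial n) \<le> \<bar>K\<bar> * hnorm ip (monomial n)"
      using hnorm_nonneg[OF monomial_mem] by (intro mult_right_mono) auto
    ultimately show ?thesis using bound[OF monomial_mem, of n] by linarith
  qed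
  have "cmod (L (monomial n) / of_real (wt n)) \<le> \<bar>K\<bar> / wt n" for n
    using K[of n] wt_pos[of n] by (simp add: norm_divide divide_right_mono)
  then obtain g where g: "g holomorphic_on ball 0 1"
    "\<And>n. taylor_coeff g n = L (monomial n) / of_real (wt n)"
    by (rule holomorphic_of_coeffs) blast
  have null: "wco d l k g = (\<lambda>z. 0)"
  proof (rule eq_if_taylor_coeff_eq)
    fix n
    have e: "wco l d k (monomial n) = wco l d k (\<lambda>z. z ^ n)"
      by (rule wco_cong[OF adm]) (simp add: monomial_def on_disk_def)
    have "(\<lambda>m. taylor_coeff (wco l d k (monomial n)) m * L (monomial m)) sums L (wco l d k (monomial n))"
      by (rule functional_expansion[where L = L, OF add scale bound wco_mem[OF adm monomial_mem]])
    then have "(\<lambda>m. of_real (wt n * gram l d k m n) * L (monomial m)) sums 0"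
      unfolding zero[OF monomial_mem] unfolding e wco_matrix[OF adm] .
    then have "(\<lambda>m. 1 / of_real (wt n) * (of_real (wt n * gram l d k m n) * L (monomial m))) sums (1 / of_real (wt n) * 0)"
      by (rule sums_mult)
    moreover have "1 / of_real (wt n) * (of_real (wt n * gram l d k m n) * L (monomial m))
        = of_real (wt m * gram d l k n m) * taylor_coeff g m" for m
      using wt_pos[of n] wt_pos[of m] by (simp add: g(2) gram_swap[of d l])
    ultimately have "(\<lambda>m. of_real (wt m * gram d l k n m) * taylor_coeff g m) sums 0"
      by (simp only: mult_zero_right)
    then have "taylor_coeff (wco d l k g) n = 0"
      by (rule sums_unique2[OF wco_expansion[OF adm' g(1)]])
    then show "taylor_coeff (wco d l k g) n = taylor_coeff (\<lambda>z. 0) n"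
      using taylor_coeff_scale[of "\<lambda>z. 0" 1 0 n] by simp
  qed (use holomorphic_wco[OF adm' g(1)] in \<open>auto simp: wco_outside\<close>)
  have "g w = 0" if "w \<in> ball 0 1" for w by (rule wco_eq_0D[OF adm' g(1) null that])
  then have "taylor_coeff g n = taylor_coeff (\<lambda>z. 0) n" for n
    by (intro taylor_coeff_cong[of 1]) auto
  then have "L (monomial n) = 0" for n
    using taylor_coeff_scale[of "\<lambda>z. 0" 1 0 n] g(2)[of n] wt_pos[of n] by simp
  moreover have "(\<lambda>n. taylor_coeff h n * L (monomial n)) sums L h"
    by (rule functional_expansion[where L = L, OF add scale bound h])
  ultimately show ?thesis by (simp add: sums_iff)
qed

text \<open>
  The preceding lemma for the functionals that take the difference of the \<open>n\<close>th Taylor coefficients.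
\<close>

lemma operator_eq_on_range_imp_eq:
  assumes adm: "admissible l d k"
    and S: "bounded_operator H ip S" and T: "bounded_operator H ip T"
    and eq: "\<And>h. h \<in> H \<Longrightarrow> S (wco l d k h) = T (wco l d k h)"
  shows "S = T"
proof (rule bounded_operator_eqI[OF S T])
  fix h assume h: "h \<in> H"
  obtain KS where KS: "KS > 0" "\<And>h. h \<in> H \<Longrightarrow> Re (ip (S h) (S h)) \<le> KS\<^sup>2 * Re (ip h h)"
    using bounded_operator_sq_bound[OF S] by blast
  obtain KT where KT: "KT > 0" "\<And>h. h \<in> H \<Longrightarrow> Re (ip (T h) (T h)) \<le> KT\<^sup>2 * Re (ip h h)"
    using bounded_operator_sq_bound[OF T] by blast
  have coeff: "cmod (taylor_coeff (R u) n) \<le> (K / sqrt (wt n)) * hnorm ip u"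
    if R: "bounded_operator H ip R" and K: "K > 0" "Re (ip (R u) (R u)) \<le> K\<^sup>2 * Re (ip u u)" and u: "u \<in> H" for R K u n
  proof -
    have "wt n * (cmod (taylor_coeff (R u) n))\<^sup>2 \<le> K\<^sup>2 * Re (ip u u)"
      using coeff_bound[OF op_mem[OF R u]] K order.trans by blast
    then have "sqrt (wt n * (cmod (taylor_coeff (R u) n))\<^sup>2) \<le> sqrt (K\<^sup>2 * Re (ip u u))" by simp
    then show ?thesis using K wt_pos[of n] by (simp add: real_sqrt_mult hnorm_def field_simps)
  qed
  show "S h = T h"
  proof (rule eq_if_taylor_coeff_eq)
    fix n
    have "taylor_coeff (S h) n - taylor_coeff (T h) n = 0"
    proof (rule functional_zero_if_zero_on_range[OF adm _ _ _ _ h,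
          where L = "\<lambda>h. taylor_coeff (S h) n - taylor_coeff (T h) n"])
      fix u assume u: "u \<in> H"
      show "cmod (taylor_coeff (S u) n - taylor_coeff (T u) n)
          \<le> (KS / sqrt (wt n) + KT / sqrt (wt n)) * hnorm ip u"
        using coeff[OF S KS(1) KS(2)[OF u] u, of n] coeff[OF T KT(1) KT(2)[OF u] u, of n]
          norm_triangle_ineq4[of "taylor_coeff (S u) n" "taylor_coeff (T u) n"]
        unfolding ring_distribs by linarith
    next
      fix u v assume "u \<in> H" "v \<in> H"
      then show "taylor_coeff (S (\<lambda>z. u z + v z)) n - taylor_coeff (T (\<lambda>z. u z + v z)) n
          = taylor_coeff (S u) n - taylor_coeff (T u) n + (taylor_coeff (S v) n - taylor_coeff (T v) n)"
        using S T by (simp add: op_add op_mem taylor_coeff_add[where r = 1] bergman_holomorphic)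
    next
      fix c u assume "u \<in> H"
      then show "taylor_coeff (S (\<lambda>z. c * u z)) n - taylor_coeff (T (\<lambda>z. c * u z)) n
          = c * (taylor_coeff (S u) n - taylor_coeff (T u) n)"
        using S T by (simp add: op_scale op_mem taylor_coeff_scale[where r = 1] bergman_holomorphic algebra_simps)
    qed (simp add: eq)
    then show "taylor_coeff (S h) n = taylor_coeff (T h) n" by simp
  qed (use op_mem[OF S h] op_mem[OF T h] bergman_holomorphic bergman_outside in auto)
qed

section \<open>Polar decomposition and Aluthge transform\<close>

lemma abs_wco:
  assumes adm: "admissible l d k" and c: "c > 0" "c * c = l * d"
  shows "abs_op H ip (wco_op l d k) = wco_op c c (l * k / c)"
proof -
  have adm': "admissible c c (l * k / c)" using adm c by (simp add: admissible_def)
  have "compose H (wco_op d l k) (wco_op l d k) = wco_op (c * c) (c * c) (2 * c * (l * k / c))"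
    using wco_op_compose[OF admissible_swap[OF adm] adm] c by (simp add: mult_ac)
  then show ?thesis unfolding abs_op_def adjoint_wco[OF adm] using sqrt_wco[OF adm'] by simp
qed

lemma wco_isometry:
  assumes "l > 0" "d > 0" "l * d = 1" "h \<in> H"
  shows "hnorm ip (wco l d 0 h) = hnorm ip h"
proof -
  have adm: "admissible l d 0" "admissible d l 0" using assms by (auto simp: admissible_def)
  have "wco d l 0 (wco l d 0 h) = h"
    using wco_wco[OF adm(2,1), of h] wco_scalar[of 1 h] assms on_disk_bergman by (simp add: mult.commute)
  then have "ip (wco l d 0 h) (wco l d 0 h) = ip h h"
    using wco_adjoint[OF adm(1) assms(4) wco_mem[OF adm(1) assms(4)]] by simp
  then show ?thesis by (simp add: hnorm_def)
qed

lemma ker_wco: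
  assumes "admissible l d k" shows "ker_op H (wco_op l d k) = {\<lambda>z. 0}"
proof (rule equalityI; rule subsetI)
  fix h assume "h \<in> ker_op H (wco_op l d k)"
  then have h: "h \<in> H" "wco l d k h = (\<lambda>z. 0)" by (auto simp: ker_op_def wco_op_apply)
  have "h z = 0" for z
    using wco_eq_0D[OF assms bergman_holomorphic[OF h(1)] h(2)] bergman_outside[OF h(1)] by blast
  then show "h \<in> {\<lambda>z. 0}" by auto
next
  fix h :: "complex \<Rightarrow> complex" assume "h \<in> {\<lambda>z. 0}"
  then have "h = (\<lambda>z. 0)" by simp
  then show "h \<in> ker_op H (wco_op l d k)"
    using zero_mem by (simp add: ker_op_def wco_op_apply wco_def on_disk_def)
qed

lemma polar_wco:
  assumes adm: "admissible l d k" and c: "c > 0" "c * c = l * d"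
  shows "polar_part H ip (wco_op l d k) = wco_op (l / c) (d / c) 0"
  unfolding polar_part_def
proof (rule the_equality)
  have pos: "l > 0" "d > 0" using adm by (auto simp: admissible_def)
  have adm0: "admissible (l / c) (d / c) 0" and adm': "admissible c c (l * k / c)"
    using adm c by (auto simp: admissible_def)
  have "l * d / (c * c) = 1" unfolding c(2) using pos by simp
  then have one: "l / c * (d / c) = 1" by (simp only: times_divide_times_eq)
  have "l * k * d / (c * c) = k" unfolding c(2) using pos by simp
  then have comp: "compose H (wco_op (l / c) (d / c) 0) (wco_op c c (l * k / c)) = wco_op l d k"
    using wco_op_compose[OF adm0 adm'] c by simp
  have "partial_isometry H ip (wco_op (l / c) (d / c) 0)"
    unfolding partial_isometry_def
    using bounded_operator_wco[OF adm0] wco_isometry[OF _ _ one] pos c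
    by (auto simp: orth_compl_def wco_op_apply)
  then show "partial_isometry H ip (wco_op (l / c) (d / c) 0) \<and>
      ker_op H (wco_op (l / c) (d / c) 0) = ker_op H (wco_op l d k) \<and>
      ker_op H (wco_op (l / c) (d / c) 0) = ker_op H (abs_op H ip (wco_op l d k)) \<and>
      wco_op l d k = compose H (wco_op (l / c) (d / c) 0) (abs_op H ip (wco_op l d k))"
    by (simp add: abs_wco[OF adm c] ker_wco adm adm0 adm' comp)
  fix U assume U: "partial_isometry H ip U \<and> ker_op H U = ker_op H (wco_op l d k) \<and>
      ker_op H U = ker_op H (abs_op H ip (wco_op l d k)) \<and>
      wco_op l d k = compose H U (abs_op H ip (wco_op l d k))"
  show "U = wco_op (l / c) (d / c) 0"
  proof (rule operator_eq_on_range_imp_eq[OF adm' _ bounded_operator_wco[OF adm0]])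
    show "bounded_operator H ip U" using U by (simp add: partial_isometry_def)
    fix h assume h: "h \<in> H"
    have "compose H U (wco_op c c (l * k / c)) h = compose H (wco_op (l / c) (d / c) 0) (wco_op c c (l * k / c)) h"
      using U comp by (simp add: abs_wco[OF adm c])
    then show "U (wco c c (l * k / c) h) = wco_op (l / c) (d / c) 0 (wco c c (l * k / c) h)"
      using h by (simp add: compose_def wco_op_apply)
  qed
qed

text \<open>
  With \<open>e\<close> the fourth root of \<open>l d\<close>, the square root of the modulus belongs to \<open>(e, e, j)\<close>; the
  transform is the product of this triple, that of the unitary factor, and this triple again.
\<close>

theorem aluthge_wco:
  assumes adm: "admissible l d k"
  shows "aluthge H ip (wco_op l d k) = wco_op l d (k * (l + d) / (2 * d))"
proof -
  have pos: "l > 0" "d > 0" "k \<ge> 0" using adm by (auto simp: admissible_def)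
  define e where "e = sqrt (sqrt (l * d))"
  have e: "e > 0" "(e * e) * (e * e) = l * d" using pos by (auto simp: e_def)
  define j where "j = l * k / (2 * e * e * e)"
  have adm_e: "admissible e e j" using e pos by (simp add: j_def admissible_def)
  have adm_V: "admissible (l / (e * e)) (d / (e * e)) 0" using e pos by (simp add: admissible_def)
  have abs: "abs_op H ip (wco_op l d k) = wco_op (e * e) (e * e) (2 * e * j)"
    using abs_wco[OF adm, of "e * e"] e by (simp add: j_def field_simps)
  have Q: "sqrt_op H ip (abs_op H ip (wco_op l d k)) = wco_op e e j"
    unfolding abs by (rule sqrt_wco[OF adm_e])
  have V: "polar_part H ip (wco_op l d k) = wco_op (l / (e * e)) (d / (e * e)) 0"
    using polar_wco[OF adm, of "e * e"] e by simp
  have VQ: "compose H (wco_op (l / (e * e)) (d / (e * e)) 0) (wco_op e e j) = wco_op (l / e) (d / e) (j * d / (e * e))"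
    using wco_op_compose[OF adm_V adm_e] e by simp
  have adm_VQ: "admissible (l / e) (d / e) (j * d / (e * e))"
    using e pos by (simp add: admissible_def j_def)
  have "l / e * j + j * d / (e * e) * e = j * (l + d) / e" using e by (simp add: field_simps)
  also have "\<dots> = l * k * (l + d) / (2 * ((e * e) * (e * e)))" by (simp add: j_def mult_ac)
  also have "\<dots> = k * (l + d) / (2 * d)" unfolding e(2) using pos by simp
  finally have k': "l / e * j + j * d / (e * e) * e = k * (l + d) / (2 * d)" .
  show ?thesis
    unfolding aluthge_def Let_def Q V VQ
    using wco_op_compose[OF adm_e adm_VQ] e unfolding k' by simp
qed

lemma iterated_aluthge_wco:
  assumes "admissible l d k"
  shows "iterated_aluthge H ip n (wco_op l d k) = wco_op l d (k * ((l + d) / (2 * d)) ^ n)"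
proof (induction n)
  case (Suc n)
  have "admissible l d (k * ((l + d) / (2 * d)) ^ n)" using assms by (simp add: admissible_def)
  then show ?case using Suc by (simp add: aluthge_wco mult_ac)
qed simp

section \<open>Factorisation into a Toeplitz and a composition operator\<close>

text \<open>
  The weights decrease, so multiplication by \<open>z\<close> is a contraction, and a
  function with absolutely summable Taylor coefficients is a multiplier. The estimate is Young's
  inequality for the convolution of the coefficients.
\<close>

lemma multiplier_mem:
  assumes g: "g holomorphic_on ball 0 1" and A: "summable (\<lambda>n. cmod (taylor_coeff g n))" and h: "h \<in> H"
  shows "on_disk (\<lambda>z. g z * h z) \<in> H"
proof (rule bergman_memI(1))
  show "on_disk (\<lambda>z. g z * h z) holomorphic_on ball 0 1"
    unfolding holomorphic_on_disk_iff by (intro holomorphic_on_mult g bergman_holomorphic h)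
  define a b where "a n = cmod (taylor_coeff g n)" "b n = wt n * (cmod (taylor_coeff h n))\<^sup>2" for n
  have a0: "a n \<ge> 0" and b0: "b n \<ge> 0" for n using wt_pos[of n] by (simp_all add: a_b_def)
  have sum_a: "sum a F \<le> suminf a" if "finite F" for F
    using A that a0 by (intro sum_le_suminf) (auto simp: a_b_def(1)[abs_def])
  have sum_b: "sum b F \<le> suminf b" if "finite F" for F
    using bergman_summable[OF h] that b0 by (intro sum_le_suminf) (auto simp: a_b_def(2)[abs_def])
  fix M
  have "wt m * (cmod (taylor_coeff (on_disk (\<lambda>z. g z * h z)) m))\<^sup>2 \<le> suminf a * (\<Sum>i\<le>m. a i * b (m - i))" for m
  proof -
    define y where "y i = cmod (taylor_coeff h (m - i))" for i
    have "cmod (taylor_coeff (on_disk (\<lambda>z. g z * h z)) m) \<le> (\<Sum>i\<le>m. sqrt (a i) * (sqrt (a i) * y i))"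
      unfolding taylor_coeff_on_disk taylor_coeff_mult[OF g bergman_holomorphic[OF h] zero_less_one]
    proof (rule sum_norm_le)
      fix i
      have "sqrt (a i) * (sqrt (a i) * y i) = a i * y i" using a0 by (simp flip: mult.assoc)
      then show "cmod (taylor_coeff g i * taylor_coeff h (m - i)) \<le> sqrt (a i) * (sqrt (a i) * y i)"
        by (simp only: norm_mult a_b_def y_def order_refl)
    qed
    then have "(cmod (taylor_coeff (on_disk (\<lambda>z. g z * h z)) m))\<^sup>2 \<le> (\<Sum>i\<le>m. sqrt (a i) * (sqrt (a i) * y i))\<^sup>2"
      by (intro power_mono) auto
    also have "\<dots> \<le> (\<Sum>i\<le>m. (sqrt (a i))\<^sup>2) * (\<Sum>i\<le>m. (sqrt (a i) * y i)\<^sup>2)"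
      by (rule Cauchy_Schwarz_ineq_sum)
    also have "\<dots> = sum a {..m} * (\<Sum>i\<le>m. a i * (y i)\<^sup>2)" using a0 by (simp add: power_mult_distrib)
    also have "\<dots> \<le> suminf a * (\<Sum>i\<le>m. a i * (y i)\<^sup>2)"
      by (intro mult_right_mono sum_a sum_nonneg mult_nonneg_nonneg a0) auto
    finally have "wt m * (cmod (taylor_coeff (on_disk (\<lambda>z. g z * h z)) m))\<^sup>2
        \<le> wt m * (suminf a * (\<Sum>i\<le>m. a i * (y i)\<^sup>2))" using wt_pos[of m] by (intro mult_left_mono) auto
    also have "\<dots> = suminf a * (\<Sum>i\<le>m. a i * (wt m * (y i)\<^sup>2))" by (simp add: sum_distrib_left mult_ac)
    also have "\<dots> \<le> suminf a * (\<Sum>i\<le>m. a i * b (m - i))"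
    proof (intro mult_left_mono sum_mono a0)
      fix i assume "i \<in> {..m}"
      then have "wt m \<le> wt (m - i)" using wt_antimono[of "m - i" i] by simp
      then show "wt m * (y i)\<^sup>2 \<le> b (m - i)" unfolding a_b_def y_def by (intro mult_right_mono) auto
    qed (use sum_a[of "{}"] in simp)
    finally show ?thesis .
  qed
  then have "(\<Sum>m<M. wt m * (cmod (taylor_coeff (on_disk (\<lambda>z. g z * h z)) m))\<^sup>2)
      \<le> (\<Sum>m<M. suminf a * (\<Sum>i\<le>m. a i * b (m - i)))" by (rule sum_mono)
  also have "\<dots> = suminf a * (\<Sum>(i, j)\<in>{(i, j). i + j < M}. a i * b j)"
    unfolding sum.triangle_reindex sum_distrib_left ..
  also have "\<dots> \<le> suminf a * (\<Sum>(i, j)\<in>{..<M} \<times> {..<M}. a i * b j)"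
    using a0 b0 sum_a[of "{}"] by (intro mult_left_mono sum_mono2) auto
  also have "\<dots> = suminf a * (sum a {..<M} * sum b {..<M})"
    by (simp add: sum_product sum.cartesian_product)
  also have "\<dots> \<le> suminf a * (suminf a * suminf b)"
    using sum_a[of "{}"] by (intro mult_left_mono mult_mono sum_a sum_b sum_nonneg a0 b0) auto
  finally show "(\<Sum>m<M. wt m * (cmod (taylor_coeff (on_disk (\<lambda>z. g z * h z)) m))\<^sup>2)
      \<le> suminf a * (suminf a * suminf b)" .
qed (rule on_disk_outside)

lemma lft_den_Re_pos_beyond_disk:
  assumes adm: "admissible l d k"
  obtains R where "R > 1" "\<And>z. z \<in> ball 0 R \<Longrightarrow> Re (lft_den l d k z) > 0"
proof -
  define r s where "r = (l - d - k) / 2" "s = (l + d + k) / 2"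
  have rs: "\<bar>r\<bar> < s" "s > 0" using den_slope_less[OF adm] by (auto simp: r_s_def)
  \<comment> \<open>Any number between \<open>1\<close> and \<open>s / |r|\<close> would do; this one is also defined for \<open>r = 0\<close>.\<close>
  define R where "R = 1 + (s - \<bar>r\<bar>) / s"
  have "\<bar>r\<bar> * ((s - \<bar>r\<bar>) / s) \<le> s * ((s - \<bar>r\<bar>) / s)" using rs by (intro mult_right_mono) auto
  also have "\<dots> = s - \<bar>r\<bar>" using rs by simp
  finally have rR: "\<bar>r\<bar> * R \<le> s" unfolding R_def distrib_left by simp
  have R: "R > 1" using rs by (simp add: R_def)
  have "Re (lft_den l d k z) > 0" if "z \<in> ball 0 R" for z
  proof -
    have "\<bar>r * Re z\<bar> < s"
    proof (cases "r = 0")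
      case False
      have "\<bar>r * Re z\<bar> \<le> \<bar>r\<bar> * cmod z" unfolding abs_mult by (intro mult_left_mono abs_Re_le_cmod) simp
      also have "\<dots> < \<bar>r\<bar> * R" using that False by simp
      finally show ?thesis using rR by simp
    qed (use rs in simp)
    moreover have "Re (lft_den l d k z) = r * Re z + s" by (simp add: lft_den_def r_s_def)
    ultimately show ?thesis by linarith
  qed
  then show ?thesis using that R by blast
qed

text \<open>
  The operator \<open>toeplitz_op \<alpha> f\<close> is defined on the Bergman space only, so a factorisation needs
  the unweighted composition to stay in the space. It is the weighted one multiplied by a power of
  the denominator, which is holomorphic on a larger disk and so has absolutely summable coefficients.
\<close>

lemma composition_lft_mem:
  assumes adm: "admissible l d k" and h: "h \<in> H"
  shows "on_disk (\<lambda>z. h (lft l d k z)) \<in> H"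
proof -
  define g where "g z = lft_den l d k z powr of_real (\<alpha> + 2)" for z
  obtain R where R: "R > 1" "\<And>z. z \<in> ball 0 R \<Longrightarrow> Re (lft_den l d k z) > 0"
    using lft_den_Re_pos_beyond_disk[OF adm] by blast
  have hol: "g holomorphic_on ball 0 R"
    unfolding g_def
  proof (intro holomorphic_intros)
    fix z :: complex assume "z \<in> ball 0 R"
    from R(2)[OF this] show "lft_den l d k z \<notin> \<real>\<^sub>\<le>\<^sub>0" by (simp add: complex_nonpos_Reals_iff)
  qed
  have "on_disk (\<lambda>z. g z * wco l d k h z) \<in> H"
    using R(1) by (intro multiplier_mem summable_norm_taylor_coeff[OF hol] wco_mem[OF adm h]
        holomorphic_on_subset[OF hol]) auto
  also have "on_disk (\<lambda>z. g z * wco l d k h z) = on_disk (\<lambda>z. h (lft l d k z))"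
  proof
    fix z
    show "on_disk (\<lambda>z. g z * wco l d k h z) z = on_disk (\<lambda>z. h (lft l d k z)) z"
    proof (cases "z \<in> ball 0 1")
      case True
      have "g z * lft_den l d k z powr (- of_real (\<alpha> + 2)) = 1"
        unfolding g_def powr_minus using lft_den_nonzero[OF adm True] by simp
      then show ?thesis unfolding on_disk_inside[OF True] wco_inside[OF True] by (simp flip: mult.assoc)
    qed (simp add: on_disk_outside)
  qed
  finally show ?thesis .
qed

lemma wco_op_eq_toeplitz_composition:
  assumes adm: "admissible l d k"
    and f: "\<And>z. z \<in> ball 0 1 \<Longrightarrow> f z = lft_den l d k z powr (- of_real (\<alpha> + 2))"
    and \<psi>: "\<And>z. z \<in> ball 0 1 \<Longrightarrow> \<psi> z = lft l d k z"
  shows "wco_op l d k = compose H (toeplitz_op \<alpha> f) (composition_op \<alpha> \<psi>)"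
proof
  fix h
  show "wco_op l d k h = compose H (toeplitz_op \<alpha> f) (composition_op \<alpha> \<psi>) h"
  proof (cases "h \<in> H")
    case True
    have C: "composition_op \<alpha> \<psi> h = on_disk (\<lambda>z. h (lft l d k z))"
      using True \<psi> by (auto simp: composition_op_def on_disk_def)
    show ?thesis
      using True composition_lft_mem[OF adm True] f
      by (auto simp: compose_def C toeplitz_op_def wco_op_apply wco_def on_disk_def)
  qed (simp add: wco_op_def compose_def)
qed

lemma composition_op_affine:
  assumes "a > 0" "a < 1"
  shows "composition_op \<alpha> (\<lambda>z. of_real a * z + of_real (1 - a)) = wco_op 1 a (1 - a)"
proof -
  have "lft_den 1 a (1 - a) z = 1" "lft_num 1 a (1 - a) z = of_real a * z + of_real (1 - a)" for z
    by (simp_all add: lft_den_def lft_num_def)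
  then show ?thesis by (auto simp: composition_op_def wco_op_def wco_def on_disk_def lft_def fun_eq_iff)
qed

end

theorem theorem2p3:
  fixes a \<alpha> :: real and n :: nat and \<phi> f \<psi> :: "complex \<Rightarrow> complex"
  assumes "0 < a" and "a < 1" and "\<alpha> > -1"
    and "\<phi> = (\<lambda>z. of_real a * z + of_real (1 - a))"
    and "f = (\<lambda>z.
          (of_real (2 ^ (n + 1) * a ^ n) /
           (- of_real ((1 - a) * ((1 + a) ^ n - 2 ^ n * a ^ n)) * z
            + of_real ((1 + a) * ((1 - a) * (1 + a) powi (int n - 1) + 2 ^ n * a ^ n))))
          powr of_real (\<alpha> + 2))"
    and "\<psi> = (\<lambda>z.
          (- of_real ((1 + a) * ((1 - a) * (1 + a) powi (int n - 1) - 2 ^ n * a ^ n)) * z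
           + of_real ((1 - a) * ((1 + a) ^ n + 2 ^ n * a ^ n))) /
          (- of_real ((1 - a) * ((1 + a) ^ n - 2 ^ n * a ^ n)) * z
           + of_real ((1 + a) * ((1 - a) * (1 + a) powi (int n - 1) + 2 ^ n * a ^ n))))"
  shows "iterated_aluthge (bergman_space \<alpha>) (bergman_inner \<alpha>) n (composition_op \<alpha> \<phi>)
       = compose (bergman_space \<alpha>) (toeplitz_op \<alpha> f) (composition_op \<alpha> \<psi>)"
proof -
  interpret bergman \<alpha> using assms(3) by unfold_locales
  \<comment> \<open>Numerator and denominator of \<open>\<psi>\<close> are those of the triple \<open>(1, a, \<kappa>)\<close>, multiplied by \<open>2 y = 2\<^sup>n\<^sup>+\<^sup>1 a\<^sup>n\<close>.\<close>
  define x y \<kappa> where "x = (1 + a) ^ n" "y = 2 ^ n * a ^ n" "\<kappa> = (1 - a) * ((1 + a) / (2 * a)) ^ n"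
  note defs = x_y_\<kappa>_def
  have adm1: "admissible 1 a (1 - a)" and adm: "admissible 1 a \<kappa>"
    using assms(1,2) by (auto simp: admissible_def defs)
  have y: "y > 0" using assms(1) by (simp add: defs)
  have \<kappa>: "y * \<kappa> = (1 - a) * x"
    using assms(1) by (simp add: defs power_divide power_mult_distrib)
  have powi: "(1 + a) * ((1 + a) powi (int n - 1)) = x"
    using assms(1) by (simp add: defs power_int_diff)
  have num_eq: "- of_real ((1 + a) * ((1 - a) * (1 + a) powi (int n - 1) - 2 ^ n * a ^ n)) * z
           + of_real ((1 - a) * ((1 + a) ^ n + 2 ^ n * a ^ n)) = of_real (2 * y) * lft_num 1 a \<kappa> z" for z
  proof -
    have "- ((1 + a) * ((1 - a) * (1 + a) powi (int n - 1) - y)) = 2 * y * ((1 + a - \<kappa>) / 2)"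
      using powi \<kappa> by (simp add: algebra_simps)
    moreover have "(1 - a) * (x + y) = 2 * y * ((1 - a + \<kappa>) / 2)" using \<kappa> by (simp add: algebra_simps)
    ultimately show ?thesis
      unfolding lft_num_def defs(1,2)[symmetric] ring_distribs(1) mult.assoc[symmetric] of_real_mult[symmetric]
        of_real_minus[symmetric] by presburger
  qed
  have den_eq: "- of_real ((1 - a) * ((1 + a) ^ n - 2 ^ n * a ^ n)) * z
            + of_real ((1 + a) * ((1 - a) * (1 + a) powi (int n - 1) + 2 ^ n * a ^ n))
           = of_real (2 * y) * lft_den 1 a \<kappa> z" for z
  proof -
    have "(1 + a) * ((1 - a) * (1 + a) powi (int n - 1) + y) = 2 * y * ((1 + a + \<kappa>) / 2)"
      using powi \<kappa> by (simp add: algebra_simps)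
    moreover have "- ((1 - a) * (x - y)) = 2 * y * ((1 - a - \<kappa>) / 2)" using \<kappa> by (simp add: algebra_simps)
    ultimately show ?thesis
      unfolding lft_den_def defs(1,2)[symmetric] ring_distribs(1) mult.assoc[symmetric] of_real_mult[symmetric]
        of_real_minus[symmetric] by presburger
  qed
  have "iterated_aluthge H ip n (composition_op \<alpha> \<phi>) = wco_op 1 a \<kappa>"
    unfolding assms(4) composition_op_affine[OF assms(1,2)] iterated_aluthge_wco[OF adm1] defs(3) ..
  also have "\<dots> = compose H (toeplitz_op \<alpha> f) (composition_op \<alpha> \<psi>)"
  proof (rule wco_op_eq_toeplitz_composition[OF adm])
    fix z :: complex assume z: "z \<in> ball 0 1"
    have D: "Re (lft_den 1 a \<kappa> z) > 0" by (rule lft_den_Re_pos[OF adm z])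
    then have D': "lft_den 1 a \<kappa> z \<noteq> 0" "lft_den 1 a \<kappa> z \<notin> \<real>\<^sub>\<le>\<^sub>0" by (auto simp: complex_nonpos_Reals_iff)
    have y2: "2 ^ (n + 1) * a ^ n = 2 * y" by (simp add: defs)
    have "f z = (of_real (2 * y) / (of_real (2 * y) * lft_den 1 a \<kappa> z)) powr of_real (\<alpha> + 2)"
      unfolding assms(5) den_eq y2 ..
    also have "of_real (2 * y) / (of_real (2 * y) * lft_den 1 a \<kappa> z) = inverse (lft_den 1 a \<kappa> z)"
      using y by (simp add: field_simps)
    also have "inverse (lft_den 1 a \<kappa> z) powr of_real (\<alpha> + 2) = lft_den 1 a \<kappa> z powr (- of_real (\<alpha> + 2))"
      using D' by (simp add: powr_def Ln_inverse del: of_real_add)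
    finally show "f z = lft_den 1 a \<kappa> z powr (- of_real (\<alpha> + 2))" .
    show "\<psi> z = lft 1 a \<kappa> z"
      unfolding assms(6) num_eq den_eq lft_def using y by simp
  qed
  finally show ?thesis .
qed

end
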